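(* Suppose $\mathcal{M}$ is a closed symmetric monoidal category with finite colimits and limits, $E$ and $E'$ are monoids in $\mathcal{M}$, and $F:\mathrm{Mod}\text{-}E\to\mathrm{Mod}\text{-}E'$ is an $\mathcal{M}$-functor. Then $FE$ is an $E\text{-}E'$-bimodule, and there is a natural transformation $$\tau: X\otimes_E FE\longrightarrow FX$$ of functors of $X\in\mathrm{Mod}\text{-}E$.
   Context: $\otimes$, $\mathrm{Hom}$, $S$ denote the monoidal product, internal hom and unit of $\mathcal{M}$. $\mathrm{Mod}\text{-}E$ is the category of right modules over the monoid $E$; $E$ is a right module over itself. For $X,Y\in\mathrm{Mod}\text{-}E$, $\mathrm{Hom}_E(X,Y)\in\mathcal{M}$ is the equalizer of the two maps $\mathrm{Hom}(X,Y)\rightrightarrows\mathrm{Hom}(X\otimes E,Y)$ induced by the actions on $X$ and on $Y$; this enriches $\mathrm{Mod}\text{-}E$ over $\mathcal{M}$. For $X$ a right and $Y$ a left $E$-module, $X\otimes_E Y$ is the coequalizer of the two maps $X\otimes E\otimes Y\rightrightarrows X\otimes Y$. An $E\text{-}E'$-bimodule has a left $E$-action and a right $E'$-action that are compatible (each action map is a map of modules for the other); if $Y$ is an $E\text{-}E'$-bimodule, $X\otimes_E Y$ is a right $E'$-module. An $\mathcal{M}$-functor $F:\mathrm{Mod}\text{-}E\to\mathrm{Mod}\text{-}E'$ is a functor enriched over $\mathcal{M}$, i.e. equipped with natural maps $\mathrm{Hom}_E(X,Y)\to\mathrm{Hom}_{E'}(FX,FY)$ compatible with composition and identities (and with the action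 of $F$ on morphisms). The bimodule structure on $FE$ has as its right $E'$-action the given one. *)

theory Defs
  imports Main
begin

section \<open>Categories, functors, natural transformations\<close>

text \<open>
  Categories are presented by hom-sets. Hom-sets with different endpoints need not be disjoint
  (a map of modules is just its underlying arrow), so the arrow part of a functor and the
  components of a natural transformation are indexed by objects.
  Composition is written in applicative order: \<open>g \<cdot> f\<close> is \<open>g\<close> after \<open>f\<close>.
\<close>

record ('o, 'a) category =
  Obj :: "'o set"
  Hom :: "'o \<Rightarrow> 'o \<Rightarrow> 'a set"
  Ident :: "'o \<Rightarrow> 'a"
  Comp :: "'a \<Rightarrow> 'a \<Rightarrow> 'a"  (infixr "\<cdot>\<index>" 70)

locale category =
  fixes C (structure)
  assumes Hom_Obj: "f \<in> Hom C A B \<Longrightarrow> A \<in> Obj C \<and> B \<in> Obj C"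
    and Ident_Hom: "A \<in> Obj C \<Longrightarrow> Ident C A \<in> Hom C A A"
    and Comp_Hom: "\<lbrakk>f \<in> Hom C A B; g \<in> Hom C B D\<rbrakk> \<Longrightarrow> g \<cdot> f \<in> Hom C A D"
    and Comp_assoc:
      "\<lbrakk>f \<in> Hom C A B; g \<in> Hom C B D; h \<in> Hom C D E\<rbrakk> \<Longrightarrow> (h \<cdot> g) \<cdot> f = h \<cdot> (g \<cdot> f)"
    and Ident_left: "f \<in> Hom C A B \<Longrightarrow> Ident C B \<cdot> f = f"
    and Ident_right: "f \<in> Hom C A B \<Longrightarrow> f \<cdot> Ident C A = f"

definition is_inverse :: "('o, 'a, 'x) category_scheme \<Rightarrow> 'o \<Rightarrow> 'o \<Rightarrow> 'a \<Rightarrow> 'a \<Rightarrow> bool" where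
  "is_inverse C A B f g \<longleftrightarrow> f \<in> Hom C A B \<and> g \<in> Hom C B A \<and>
     g \<cdot>\<^bsub>C\<^esub> f = Ident C A \<and> f \<cdot>\<^bsub>C\<^esub> g = Ident C B"

definition is_iso :: "('o, 'a, 'x) category_scheme \<Rightarrow> 'o \<Rightarrow> 'o \<Rightarrow> 'a \<Rightarrow> bool" where
  "is_iso C A B f \<longleftrightarrow> (\<exists>g. is_inverse C A B f g)"

definition inverse_arrow :: "('o, 'a, 'x) category_scheme \<Rightarrow> 'o \<Rightarrow> 'o \<Rightarrow> 'a \<Rightarrow> 'a" where
  "inverse_arrow C A B f = (THE g. is_inverse C A B f g)"

record ('o, 'a, 'p, 'b) functor_data =
  fobj :: "'o \<Rightarrow> 'p"
  farr :: "'o \<Rightarrow> 'o \<Rightarrow> 'a \<Rightarrow> 'b"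

definition is_functor ::
  "('o, 'a, 'x) category_scheme \<Rightarrow> ('p, 'b, 'y) category_scheme \<Rightarrow> ('o, 'a, 'p, 'b) functor_data
    \<Rightarrow> bool" where
  "is_functor C D F \<longleftrightarrow> category C \<and> category D \<and>
     (\<forall>A\<in>Obj C. fobj F A \<in> Obj D) \<and>
     (\<forall>A B. \<forall>f\<in>Hom C A B. farr F A B f \<in> Hom D (fobj F A) (fobj F B)) \<and>
     (\<forall>A\<in>Obj C. farr F A A (Ident C A) = Ident D (fobj F A)) \<and>
     (\<forall>A B K. \<forall>f\<in>Hom C A B. \<forall>g\<in>Hom C B K.
        farr F A K (g \<cdot>\<^bsub>C\<^esub> f) = farr F B K g \<cdot>\<^bsub>D\<^esub> farr F A B f)"

definition is_nat_trans ::
  "('o, 'a, 'x) category_scheme \<Rightarrow> ('p, 'b, 'y) category_scheme \<Rightarrow> ('o, 'a, 'p, 'b) functor_data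
    \<Rightarrow> ('o, 'a, 'p, 'b) functor_data \<Rightarrow> ('o \<Rightarrow> 'b) \<Rightarrow> bool" where
  "is_nat_trans C D F G \<tau> \<longleftrightarrow> is_functor C D F \<and> is_functor C D G \<and>
     (\<forall>A\<in>Obj C. \<tau> A \<in> Hom D (fobj F A) (fobj G A)) \<and>
     (\<forall>A B. \<forall>f\<in>Hom C A B. \<tau> B \<cdot>\<^bsub>D\<^esub> farr F A B f = farr G A B f \<cdot>\<^bsub>D\<^esub> \<tau> A)"


section \<open>Finite limits and colimits\<close>

definition is_finite_category :: "('j, 'u, 'x) category_scheme \<Rightarrow> bool" where
  "is_finite_category J \<longleftrightarrow> category J \<and> finite (Obj J) \<and>
     (\<forall>i\<in>Obj J. \<forall>j\<in>Obj J. finite (Hom J i j))"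

definition is_cone ::
  "('j, 'u, 'x) category_scheme \<Rightarrow> ('o, 'a, 'y) category_scheme \<Rightarrow> ('j, 'u, 'o, 'a) functor_data
    \<Rightarrow> 'o \<Rightarrow> ('j \<Rightarrow> 'a) \<Rightarrow> bool" where
  "is_cone J C D L p \<longleftrightarrow> L \<in> Obj C \<and> (\<forall>j\<in>Obj J. p j \<in> Hom C L (fobj D j)) \<and>
     (\<forall>i j. \<forall>u\<in>Hom J i j. farr D i j u \<cdot>\<^bsub>C\<^esub> p i = p j)"

definition is_limit ::
  "('j, 'u, 'x) category_scheme \<Rightarrow> ('o, 'a, 'y) category_scheme \<Rightarrow> ('j, 'u, 'o, 'a) functor_data
    \<Rightarrow> 'o \<Rightarrow> ('j \<Rightarrow> 'a) \<Rightarrow> bool" where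
  "is_limit J C D L p \<longleftrightarrow> is_cone J C D L p \<and>
     (\<forall>L' p'. is_cone J C D L' p' \<longrightarrow>
        (\<exists>!h. h \<in> Hom C L' L \<and> (\<forall>j\<in>Obj J. p j \<cdot>\<^bsub>C\<^esub> h = p' j)))"

definition is_cocone ::
  "('j, 'u, 'x) category_scheme \<Rightarrow> ('o, 'a, 'y) category_scheme \<Rightarrow> ('j, 'u, 'o, 'a) functor_data
    \<Rightarrow> 'o \<Rightarrow> ('j \<Rightarrow> 'a) \<Rightarrow> bool" where
  "is_cocone J C D L p \<longleftrightarrow> L \<in> Obj C \<and> (\<forall>j\<in>Obj J. p j \<in> Hom C (fobj D j) L) \<and>
     (\<forall>i j. \<forall>u\<in>Hom J i j. p j \<cdot>\<^bsub>C\<^esub> farr D i j u = p i)"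

definition is_colimit ::
  "('j, 'u, 'x) category_scheme \<Rightarrow> ('o, 'a, 'y) category_scheme \<Rightarrow> ('j, 'u, 'o, 'a) functor_data
    \<Rightarrow> 'o \<Rightarrow> ('j \<Rightarrow> 'a) \<Rightarrow> bool" where
  "is_colimit J C D L p \<longleftrightarrow> is_cocone J C D L p \<and>
     (\<forall>L' p'. is_cocone J C D L' p' \<longrightarrow>
        (\<exists>!h. h \<in> Hom C L L' \<and> (\<forall>j\<in>Obj J. h \<cdot>\<^bsub>C\<^esub> p j = p' j)))"

text \<open>Every finite category is isomorphic to one whose objects and arrows are natural numbers.\<close>

definition has_finite_limits :: "('o, 'a, 'x) category_scheme \<Rightarrow> bool" where
  "has_finite_limits C \<longleftrightarrow> (\<forall>(J :: (nat, nat) category) D.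
     is_finite_category J \<and> is_functor J C D \<longrightarrow> (\<exists>L p. is_limit J C D L p))"

definition has_finite_colimits :: "('o, 'a, 'x) category_scheme \<Rightarrow> bool" where
  "has_finite_colimits C \<longleftrightarrow> (\<forall>(J :: (nat, nat) category) D.
     is_finite_category J \<and> is_functor J C D \<longrightarrow> (\<exists>L p. is_colimit J C D L p))"

definition is_equalizer ::
  "('o, 'a, 'x) category_scheme \<Rightarrow> 'o \<Rightarrow> 'o \<Rightarrow> 'a \<Rightarrow> 'a \<Rightarrow> 'o \<Rightarrow> 'a \<Rightarrow> bool" where
  "is_equalizer C A B f g K k \<longleftrightarrow> f \<in> Hom C A B \<and> g \<in> Hom C A B \<and> k \<in> Hom C K A \<and>
     f \<cdot>\<^bsub>C\<^esub> k = g \<cdot>\<^bsub>C\<^esub> k \<and>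
     (\<forall>Z. \<forall>h\<in>Hom C Z A. f \<cdot>\<^bsub>C\<^esub> h = g \<cdot>\<^bsub>C\<^esub> h \<longrightarrow> (\<exists>!u. u \<in> Hom C Z K \<and> k \<cdot>\<^bsub>C\<^esub> u = h))"

definition is_coequalizer ::
  "('o, 'a, 'x) category_scheme \<Rightarrow> 'o \<Rightarrow> 'o \<Rightarrow> 'a \<Rightarrow> 'a \<Rightarrow> 'o \<Rightarrow> 'a \<Rightarrow> bool" where
  "is_coequalizer C A B f g Q q \<longleftrightarrow> f \<in> Hom C A B \<and> g \<in> Hom C A B \<and> q \<in> Hom C B Q \<and>
     q \<cdot>\<^bsub>C\<^esub> f = q \<cdot>\<^bsub>C\<^esub> g \<and>
     (\<forall>Z. \<forall>h\<in>Hom C B Z. h \<cdot>\<^bsub>C\<^esub> f = h \<cdot>\<^bsub>C\<^esub> g \<longrightarrow> (\<exists>!u. u \<in> Hom C Q Z \<and> u \<cdot>\<^bsub>C\<^esub> q = h))"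

text \<open>A chosen equalizer (object and inclusion) and coequalizer (object and projection).\<close>

definition equalizer ::
  "('o, 'a, 'x) category_scheme \<Rightarrow> 'o \<Rightarrow> 'o \<Rightarrow> 'a \<Rightarrow> 'a \<Rightarrow> 'o \<times> 'a" where
  "equalizer C A B f g = (SOME (K, k). is_equalizer C A B f g K k)"

definition coequalizer ::
  "('o, 'a, 'x) category_scheme \<Rightarrow> 'o \<Rightarrow> 'o \<Rightarrow> 'a \<Rightarrow> 'a \<Rightarrow> 'o \<times> 'a" where
  "coequalizer C A B f g = (SOME (Q, q). is_coequalizer C A B f g Q q)"


section \<open>Closed symmetric monoidal categories\<close>

text \<open>
  \<open>Assoc M A B D : (A \<otimes> B) \<otimes> D \<rightarrow> A \<otimes> (B \<otimes> D)\<close>, \<open>LUnit M A : S \<otimes> A \<rightarrow> A\<close>,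
  \<open>RUnit M A : A \<otimes> S \<rightarrow> A\<close>, \<open>Braid M A B : A \<otimes> B \<rightarrow> B \<otimes> A\<close>, and
  \<open>Eval M A B : IHom M A B \<otimes> A \<rightarrow> B\<close>, where \<open>S\<close> is \<open>MUnit M\<close>.
\<close>

record ('o, 'a) monoidal_data = "('o, 'a) category" +
  Tensor :: "'o \<Rightarrow> 'o \<Rightarrow> 'o"  (infixl "\<otimes>\<index>" 75)
  TensorArr :: "'a \<Rightarrow> 'a \<Rightarrow> 'a"  (infixl "\<otimes>\<^sub>a\<index>" 75)
  MUnit :: "'o"
  Assoc :: "'o \<Rightarrow> 'o \<Rightarrow> 'o \<Rightarrow> 'a"
  LUnit :: "'o \<Rightarrow> 'a"
  RUnit :: "'o \<Rightarrow> 'a"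

record ('o, 'a) symmetric_monoidal_data = "('o, 'a) monoidal_data" +
  Braid :: "'o \<Rightarrow> 'o \<Rightarrow> 'a"

record ('o, 'a) closed_monoidal_data = "('o, 'a) symmetric_monoidal_data" +
  IHom :: "'o \<Rightarrow> 'o \<Rightarrow> 'o"
  Eval :: "'o \<Rightarrow> 'o \<Rightarrow> 'a"

locale monoidal_category = category M for M (structure) +
  assumes Tensor_Obj: "\<lbrakk>A \<in> Obj M; B \<in> Obj M\<rbrakk> \<Longrightarrow> A \<otimes> B \<in> Obj M"
    and TensorArr_Hom:
      "\<lbrakk>f \<in> Hom M A A'; g \<in> Hom M B B'\<rbrakk> \<Longrightarrow> f \<otimes>\<^sub>a g \<in> Hom M (A \<otimes> B) (A' \<otimes> B')"
    and TensorArr_Ident: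
      "\<lbrakk>A \<in> Obj M; B \<in> Obj M\<rbrakk> \<Longrightarrow> Ident M A \<otimes>\<^sub>a Ident M B = Ident M (A \<otimes> B)"
    and TensorArr_Comp:
      "\<lbrakk>f \<in> Hom M A A'; f' \<in> Hom M A' A''; g \<in> Hom M B B'; g' \<in> Hom M B' B''\<rbrakk> \<Longrightarrow>
        (f' \<cdot> f) \<otimes>\<^sub>a (g' \<cdot> g) = (f' \<otimes>\<^sub>a g') \<cdot> (f \<otimes>\<^sub>a g)"
    and MUnit_Obj: "MUnit M \<in> Obj M"
    and Assoc_iso:
      "\<lbrakk>A \<in> Obj M; B \<in> Obj M; D \<in> Obj M\<rbrakk> \<Longrightarrow>
        is_iso M ((A \<otimes> B) \<otimes> D) (A \<otimes> (B \<otimes> D)) (Assoc M A B D)"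
    and LUnit_iso: "A \<in> Obj M \<Longrightarrow> is_iso M (MUnit M \<otimes> A) A (LUnit M A)"
    and RUnit_iso: "A \<in> Obj M \<Longrightarrow> is_iso M (A \<otimes> MUnit M) A (RUnit M A)"
    and Assoc_natural:
      "\<lbrakk>f \<in> Hom M A A'; g \<in> Hom M B B'; h \<in> Hom M D D'\<rbrakk> \<Longrightarrow>
        Assoc M A' B' D' \<cdot> ((f \<otimes>\<^sub>a g) \<otimes>\<^sub>a h) = (f \<otimes>\<^sub>a (g \<otimes>\<^sub>a h)) \<cdot> Assoc M A B D"
    and LUnit_natural:
      "f \<in> Hom M A A' \<Longrightarrow> LUnit M A' \<cdot> (Ident M (MUnit M) \<otimes>\<^sub>a f) = f \<cdot> LUnit M A"
    and RUnit_natural: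
      "f \<in> Hom M A A' \<Longrightarrow> RUnit M A' \<cdot> (f \<otimes>\<^sub>a Ident M (MUnit M)) = f \<cdot> RUnit M A"
    and pentagon:
      "\<lbrakk>A \<in> Obj M; B \<in> Obj M; D \<in> Obj M; E \<in> Obj M\<rbrakk> \<Longrightarrow>
        Assoc M A B (D \<otimes> E) \<cdot> Assoc M (A \<otimes> B) D E =
        (Ident M A \<otimes>\<^sub>a Assoc M B D E) \<cdot> Assoc M A (B \<otimes> D) E \<cdot> (Assoc M A B D \<otimes>\<^sub>a Ident M E)"
    and triangle:
      "\<lbrakk>A \<in> Obj M; B \<in> Obj M\<rbrakk> \<Longrightarrow>
        (Ident M A \<otimes>\<^sub>a LUnit M B) \<cdot> Assoc M A (MUnit M) B = RUnit M A \<otimes>\<^sub>a Ident M B"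

locale symmetric_monoidal_category = monoidal_category M for M (structure) +
  assumes Braid_Hom: "\<lbrakk>A \<in> Obj M; B \<in> Obj M\<rbrakk> \<Longrightarrow> Braid M A B \<in> Hom M (A \<otimes> B) (B \<otimes> A)"
    and Braid_natural:
      "\<lbrakk>f \<in> Hom M A A'; g \<in> Hom M B B'\<rbrakk> \<Longrightarrow>
        Braid M A' B' \<cdot> (f \<otimes>\<^sub>a g) = (g \<otimes>\<^sub>a f) \<cdot> Braid M A B"
    and Braid_symmetric:
      "\<lbrakk>A \<in> Obj M; B \<in> Obj M\<rbrakk> \<Longrightarrow> Braid M B A \<cdot> Braid M A B = Ident M (A \<otimes> B)"
    and hexagon:
      "\<lbrakk>A \<in> Obj M; B \<in> Obj M; D \<in> Obj M\<rbrakk> \<Longrightarrow>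
        Assoc M B D A \<cdot> Braid M A (B \<otimes> D) \<cdot> Assoc M A B D =
        (Ident M B \<otimes>\<^sub>a Braid M A D) \<cdot> Assoc M B A D \<cdot> (Braid M A B \<otimes>\<^sub>a Ident M D)"

locale closed_symmetric_monoidal_category = symmetric_monoidal_category M for M (structure) +
  assumes IHom_Obj: "\<lbrakk>A \<in> Obj M; B \<in> Obj M\<rbrakk> \<Longrightarrow> IHom M A B \<in> Obj M"
    and Eval_Hom: "\<lbrakk>A \<in> Obj M; B \<in> Obj M\<rbrakk> \<Longrightarrow> Eval M A B \<in> Hom M (IHom M A B \<otimes> A) B"
    and Eval_universal:
      "\<lbrakk>A \<in> Obj M; B \<in> Obj M; Z \<in> Obj M; f \<in> Hom M (Z \<otimes> A) B\<rbrakk> \<Longrightarrow>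
        \<exists>!g. g \<in> Hom M Z (IHom M A B) \<and> Eval M A B \<cdot> (g \<otimes>\<^sub>a Ident M A) = f"


section \<open>Monoids, modules and bimodules\<close>

record ('o, 'a) monoid_data =
  MonObj :: "'o"
  MonMult :: "'a"
  MonUnit :: "'a"

record ('o, 'a) module_data =
  ModObj :: "'o"
  ModAct :: "'a"

context
  fixes M :: "('o, 'a) closed_monoidal_data" (structure)
begin

definition is_monoid :: "('o, 'a) monoid_data \<Rightarrow> bool" where
  "is_monoid E \<longleftrightarrow>
     (let e = MonObj E; m = MonMult E; u = MonUnit E in
       e \<in> Obj M \<and> m \<in> Hom M (e \<otimes> e) e \<and> u \<in> Hom M (MUnit M) e \<and>
       m \<cdot> (m \<otimes>\<^sub>a Ident M e) = m \<cdot> (Ident M e \<otimes>\<^sub>a m) \<cdot> Assoc M e e e \<and>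
       m \<cdot> (u \<otimes>\<^sub>a Ident M e) = LUnit M e \<and>
       m \<cdot> (Ident M e \<otimes>\<^sub>a u) = RUnit M e)"

definition is_right_module :: "('o, 'a) monoid_data \<Rightarrow> ('o, 'a) module_data \<Rightarrow> bool" where
  "is_right_module E X \<longleftrightarrow>
     (let e = MonObj E; x = ModObj X; r = ModAct X in
       x \<in> Obj M \<and> r \<in> Hom M (x \<otimes> e) x \<and>
       r \<cdot> (r \<otimes>\<^sub>a Ident M e) = r \<cdot> (Ident M x \<otimes>\<^sub>a MonMult E) \<cdot> Assoc M x e e \<and>
       r \<cdot> (Ident M x \<otimes>\<^sub>a MonUnit E) = RUnit M x)"

definition is_left_module :: "('o, 'a) monoid_data \<Rightarrow> ('o, 'a) module_data \<Rightarrow> bool" where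
  "is_left_module E Y \<longleftrightarrow>
     (let e = MonObj E; y = ModObj Y; l = ModAct Y in
       y \<in> Obj M \<and> l \<in> Hom M (e \<otimes> y) y \<and>
       l \<cdot> (MonMult E \<otimes>\<^sub>a Ident M y) = l \<cdot> (Ident M e \<otimes>\<^sub>a l) \<cdot> Assoc M e e y \<and>
       l \<cdot> (MonUnit E \<otimes>\<^sub>a Ident M y) = LUnit M y)"

text \<open>
  An \<open>E\<close>-\<open>E'\<close>-bimodule is a right \<open>E'\<close>-module \<open>Y\<close> with a left action \<open>l\<close> of \<open>E\<close> on its underlying
  object. The last equation says both that \<open>l\<close> is a map of right \<open>E'\<close>-modules and that the right
  action is a map of left \<open>E\<close>-modules.
\<close>

definition is_bimodule ::
  "('o, 'a) monoid_data \<Rightarrow> ('o, 'a) monoid_data \<Rightarrow> ('o, 'a) module_data \<Rightarrow> 'a \<Rightarrow> bool" where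
  "is_bimodule E E' Y l \<longleftrightarrow>
     is_left_module E \<lparr>ModObj = ModObj Y, ModAct = l\<rparr> \<and> is_right_module E' Y \<and>
     ModAct Y \<cdot> (l \<otimes>\<^sub>a Ident M (MonObj E')) =
       l \<cdot> (Ident M (MonObj E) \<otimes>\<^sub>a ModAct Y) \<cdot> Assoc M (MonObj E) (ModObj Y) (MonObj E')"

definition Mod :: "('o, 'a) monoid_data \<Rightarrow> (('o, 'a) module_data, 'a) category" where
  "Mod E = \<lparr>
     Obj = {X. is_right_module E X},
     Hom = (\<lambda>X Y. {f. is_right_module E X \<and> is_right_module E Y \<and>
                       f \<in> Hom M (ModObj X) (ModObj Y) \<and>
                       f \<cdot> ModAct X = ModAct Y \<cdot> (f \<otimes>\<^sub>a Ident M (MonObj E))}),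
     Ident = (\<lambda>X. Ident M (ModObj X)),
     Comp = Comp M\<rparr>"

definition regular_module :: "('o, 'a) monoid_data \<Rightarrow> ('o, 'a) module_data" where
  "regular_module E = \<lparr>ModObj = MonObj E, ModAct = MonMult E\<rparr>"


section \<open>The enrichment of the category of right modules\<close>

text \<open>The adjoint \<open>Z \<rightarrow> IHom M A B\<close> of \<open>f : Z \<otimes> A \<rightarrow> B\<close>.\<close>

definition transpose :: "'o \<Rightarrow> 'o \<Rightarrow> 'o \<Rightarrow> 'a \<Rightarrow> 'a" where
  "transpose A B Z f =
     (THE g. g \<in> Hom M Z (IHom M A B) \<and> Eval M A B \<cdot> (g \<otimes>\<^sub>a Ident M A) = f)"

text \<open>\<open>IHom M X Y \<rightarrow> IHom M X' Y'\<close> induced by \<open>u : X' \<rightarrow> X\<close> and \<open>v : Y \<rightarrow> Y'\<close>.\<close>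

definition ihom_map :: "'o \<Rightarrow> 'o \<Rightarrow> 'o \<Rightarrow> 'o \<Rightarrow> 'a \<Rightarrow> 'a \<Rightarrow> 'a" where
  "ihom_map X' X Y Y' u v =
     transpose X' Y' (IHom M X Y) (v \<cdot> Eval M X Y \<cdot> (Ident M (IHom M X Y) \<otimes>\<^sub>a u))"

definition ihom_comp :: "'o \<Rightarrow> 'o \<Rightarrow> 'o \<Rightarrow> 'a" where
  "ihom_comp X Y Z =
     transpose X Z (IHom M Y Z \<otimes> IHom M X Y)
       (Eval M Y Z \<cdot> (Ident M (IHom M Y Z) \<otimes>\<^sub>a Eval M X Y) \<cdot> Assoc M (IHom M Y Z) (IHom M X Y) X)"

text \<open>The arrow \<open>MUnit M \<rightarrow> IHom M X Y\<close> corresponding to \<open>f : X \<rightarrow> Y\<close>.\<close>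

definition ihom_name :: "'o \<Rightarrow> 'o \<Rightarrow> 'a \<Rightarrow> 'a" where
  "ihom_name X Y f = transpose X Y (MUnit M) (f \<cdot> LUnit M X)"

text \<open>
  The two maps \<open>IHom M X Y \<rightarrow> IHom M (X \<otimes> E) Y\<close>. The one induced by the action on \<open>X\<close> is
  precomposition; the one induced by the action on \<open>Y\<close> is adjoint to
  \<open>IHom M X Y \<otimes> (X \<otimes> E) \<cong> (IHom M X Y \<otimes> X) \<otimes> E \<rightarrow> Y \<otimes> E \<rightarrow> Y\<close>.
\<close>

definition hom_act_dom ::
  "('o, 'a) monoid_data \<Rightarrow> ('o, 'a) module_data \<Rightarrow> ('o, 'a) module_data \<Rightarrow> 'a" where
  "hom_act_dom E X Y =
     ihom_map (ModObj X \<otimes> MonObj E) (ModObj X) (ModObj Y) (ModObj Y)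
       (ModAct X) (Ident M (ModObj Y))"

definition hom_act_cod ::
  "('o, 'a) monoid_data \<Rightarrow> ('o, 'a) module_data \<Rightarrow> ('o, 'a) module_data \<Rightarrow> 'a" where
  "hom_act_cod E X Y =
     (let e = MonObj E; x = ModObj X; y = ModObj Y; h = IHom M x y in
       transpose (x \<otimes> e) y h
         (ModAct Y \<cdot> (Eval M x y \<otimes>\<^sub>a Ident M e) \<cdot>
          inverse_arrow M ((h \<otimes> x) \<otimes> e) (h \<otimes> (x \<otimes> e)) (Assoc M h x e)))"

definition modhom_equalizer ::
  "('o, 'a) monoid_data \<Rightarrow> ('o, 'a) module_data \<Rightarrow> ('o, 'a) module_data \<Rightarrow> 'o \<times> 'a" where
  "modhom_equalizer E X Y =
     equalizer M (IHom M (ModObj X) (ModObj Y)) (IHom M (ModObj X \<otimes> MonObj E) (ModObj Y))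
       (hom_act_dom E X Y) (hom_act_cod E X Y)"

definition modhom ::
  "('o, 'a) monoid_data \<Rightarrow> ('o, 'a) module_data \<Rightarrow> ('o, 'a) module_data \<Rightarrow> 'o" where
  "modhom E X Y = fst (modhom_equalizer E X Y)"

definition modhom_incl ::
  "('o, 'a) monoid_data \<Rightarrow> ('o, 'a) module_data \<Rightarrow> ('o, 'a) module_data \<Rightarrow> 'a" where
  "modhom_incl E X Y = snd (modhom_equalizer E X Y)"

text \<open>
  Composition, the arrow \<open>MUnit M \<rightarrow> modhom E X Y\<close> corresponding to a module map, identities and
  functoriality of \<open>modhom\<close> are the restrictions of those of the internal hom.
\<close>

definition modhom_comp ::
  "('o, 'a) monoid_data \<Rightarrow> ('o, 'a) module_data \<Rightarrow> ('o, 'a) module_data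
    \<Rightarrow> ('o, 'a) module_data \<Rightarrow> 'a" where
  "modhom_comp E X Y Z =
     (THE c. c \<in> Hom M (modhom E Y Z \<otimes> modhom E X Y) (modhom E X Z) \<and>
        modhom_incl E X Z \<cdot> c =
        ihom_comp (ModObj X) (ModObj Y) (ModObj Z) \<cdot> (modhom_incl E Y Z \<otimes>\<^sub>a modhom_incl E X Y))"

definition modhom_name ::
  "('o, 'a) monoid_data \<Rightarrow> ('o, 'a) module_data \<Rightarrow> ('o, 'a) module_data \<Rightarrow> 'a \<Rightarrow> 'a" where
  "modhom_name E X Y f =
     (THE n. n \<in> Hom M (MUnit M) (modhom E X Y) \<and>
        modhom_incl E X Y \<cdot> n = ihom_name (ModObj X) (ModObj Y) f)"

definition modhom_id :: "('o, 'a) monoid_data \<Rightarrow> ('o, 'a) module_data \<Rightarrow> 'a" where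
  "modhom_id E X = modhom_name E X X (Ident M (ModObj X))"

definition modhom_map ::
  "('o, 'a) monoid_data \<Rightarrow> ('o, 'a) module_data \<Rightarrow> ('o, 'a) module_data
    \<Rightarrow> ('o, 'a) module_data \<Rightarrow> ('o, 'a) module_data \<Rightarrow> 'a \<Rightarrow> 'a \<Rightarrow> 'a" where
  "modhom_map E X' X Y Y' u v =
     (THE h. h \<in> Hom M (modhom E X Y) (modhom E X' Y') \<and>
        modhom_incl E X' Y' \<cdot> h =
        ihom_map (ModObj X') (ModObj X) (ModObj Y) (ModObj Y') u v \<cdot> modhom_incl E X Y)"

text \<open>
  A functor \<open>F\<close> from right \<open>E\<close>-modules to right \<open>E'\<close>-modules, enriched by maps
  \<open>\<Phi> X Y : modhom E X Y \<rightarrow> modhom E' (F X) (F Y)\<close>.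
\<close>

definition is_enriched_functor ::
  "('o, 'a) monoid_data \<Rightarrow> ('o, 'a) monoid_data
    \<Rightarrow> (('o, 'a) module_data, 'a, ('o, 'a) module_data, 'a) functor_data
    \<Rightarrow> (('o, 'a) module_data \<Rightarrow> ('o, 'a) module_data \<Rightarrow> 'a) \<Rightarrow> bool" where
  "is_enriched_functor E E' F \<Phi> \<longleftrightarrow>
     is_functor (Mod E) (Mod E') F \<and>
     (\<forall>X\<in>Obj (Mod E). \<forall>Y\<in>Obj (Mod E).
        \<Phi> X Y \<in> Hom M (modhom E X Y) (modhom E' (fobj F X) (fobj F Y))) \<and>
     (\<forall>X' X Y Y'. \<forall>u\<in>Hom (Mod E) X' X. \<forall>v\<in>Hom (Mod E) Y Y'.
        \<Phi> X' Y' \<cdot> modhom_map E X' X Y Y' u v =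
        modhom_map E' (fobj F X') (fobj F X) (fobj F Y) (fobj F Y')
          (farr F X' X u) (farr F Y Y' v) \<cdot> \<Phi> X Y) \<and>
     (\<forall>X\<in>Obj (Mod E). \<forall>Y\<in>Obj (Mod E). \<forall>Z\<in>Obj (Mod E).
        \<Phi> X Z \<cdot> modhom_comp E X Y Z =
        modhom_comp E' (fobj F X) (fobj F Y) (fobj F Z) \<cdot> (\<Phi> Y Z \<otimes>\<^sub>a \<Phi> X Y)) \<and>
     (\<forall>X\<in>Obj (Mod E). \<Phi> X X \<cdot> modhom_id E X = modhom_id E' (fobj F X)) \<and>
     (\<forall>X Y. \<forall>f\<in>Hom (Mod E) X Y.
        \<Phi> X Y \<cdot> modhom_name E X Y f = modhom_name E' (fobj F X) (fobj F Y) (farr F X Y f))"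


section \<open>Tensor product over a monoid\<close>

definition tensor_over_coequalizer ::
  "('o, 'a) monoid_data \<Rightarrow> ('o, 'a) module_data \<Rightarrow> ('o, 'a) module_data \<Rightarrow> 'o \<times> 'a" where
  "tensor_over_coequalizer E X Y =
     (let e = MonObj E; x = ModObj X; y = ModObj Y in
       coequalizer M ((x \<otimes> e) \<otimes> y) (x \<otimes> y)
         (ModAct X \<otimes>\<^sub>a Ident M y) ((Ident M x \<otimes>\<^sub>a ModAct Y) \<cdot> Assoc M x e y))"

definition tensor_over ::
  "('o, 'a) monoid_data \<Rightarrow> ('o, 'a) module_data \<Rightarrow> ('o, 'a) module_data \<Rightarrow> 'o" where
  "tensor_over E X Y = fst (tensor_over_coequalizer E X Y)"

definition tensor_over_proj ::
  "('o, 'a) monoid_data \<Rightarrow> ('o, 'a) module_data \<Rightarrow> ('o, 'a) module_data \<Rightarrow> 'a" where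
  "tensor_over_proj E X Y = snd (tensor_over_coequalizer E X Y)"

text \<open>
  For an \<open>E\<close>-\<open>E'\<close>-bimodule \<open>(Y, l)\<close>, the functor taking \<open>X\<close> to the tensor product of \<open>X\<close> and \<open>Y\<close> over
  \<open>E\<close>, with the right \<open>E'\<close>-action induced from that of \<open>Y\<close>.
\<close>

definition tensor_over_module ::
  "('o, 'a) monoid_data \<Rightarrow> ('o, 'a) monoid_data \<Rightarrow> ('o, 'a) module_data \<Rightarrow> 'a
    \<Rightarrow> ('o, 'a) module_data \<Rightarrow> ('o, 'a) module_data" where
  "tensor_over_module E E' Y l X =
     (let Yl = \<lparr>ModObj = ModObj Y, ModAct = l\<rparr>; e' = MonObj E';
          Q = tensor_over E X Yl; q = tensor_over_proj E X Yl in
       \<lparr>ModObj = Q,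
        ModAct = (THE r. r \<in> Hom M (Q \<otimes> e') Q \<and>
          r \<cdot> (q \<otimes>\<^sub>a Ident M e') =
          q \<cdot> (Ident M (ModObj X) \<otimes>\<^sub>a ModAct Y) \<cdot> Assoc M (ModObj X) (ModObj Y) e')\<rparr>)"

definition tensor_over_functor ::
  "('o, 'a) monoid_data \<Rightarrow> ('o, 'a) monoid_data \<Rightarrow> ('o, 'a) module_data \<Rightarrow> 'a
    \<Rightarrow> (('o, 'a) module_data, 'a, ('o, 'a) module_data, 'a) functor_data" where
  "tensor_over_functor E E' Y l =
     (let Yl = \<lparr>ModObj = ModObj Y, ModAct = l\<rparr> in
       \<lparr>fobj = tensor_over_module E E' Y l,
        farr = (\<lambda>X X' f. THE h. h \<in> Hom M (tensor_over E X Yl) (tensor_over E X' Yl) \<and>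
          h \<cdot> tensor_over_proj E X Yl =
          tensor_over_proj E X' Yl \<cdot> (f \<otimes>\<^sub>a Ident M (ModObj Y)))\<rparr>)"

end

end

theory Submission
  imports Defs
begin

text \<open>
  Maps \<open>Z \<rightarrow> Hom\<^sub>E(X, Y)\<close> correspond to maps \<open>Z \<otimes> X \<rightarrow> Y\<close> that commute with the actions of \<open>E\<close> on \<open>X\<close> and
  \<open>Y\<close>. Under this adjunction the action \<open>X \<otimes> E \<rightarrow> X\<close> of a right module corresponds to a map
  \<open>X \<rightarrow> Hom\<^sub>E(E, X)\<close>; composing it with the enrichment \<open>Hom\<^sub>E(E, X) \<rightarrow> Hom\<^sub>E\<^sub>'(FE, FX)\<close> and passing
  back yields \<open>\<sigma> X : X \<otimes> FE \<rightarrow> FX\<close>. The left action of \<open>E\<close> on \<open>FE\<close> is \<open>\<sigma> E\<close>. Compatibility of the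
  enrichment with composition gives \<open>\<sigma> X \<cdot> (r \<otimes> 1) = \<sigma> X \<cdot> (1 \<otimes> \<sigma> E) \<cdot> \<alpha>\<close>: for \<open>X = E\<close> this is associativity
  of the left action, and in general it says that \<open>\<sigma> X\<close> factors through \<open>X \<otimes>\<^sub>E FE\<close>. Compatibility with
  identities gives the unit law, and naturality of the enrichment gives naturality of \<open>\<sigma>\<close>.
  The right action on \<open>X \<otimes>\<^sub>E Y\<close> exists because \<open>- \<otimes> D\<close>, being a left adjoint, preserves coequalizers.
\<close>

section \<open>Monoidal categories\<close>

context category begin

lemma Hom_Obj1: "f \<in> Hom C A B \<Longrightarrow> A \<in> Obj C" and Hom_Obj2: "f \<in> Hom C A B \<Longrightarrow> B \<in> Obj C"
  using Hom_Obj by auto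

lemma is_inverse_unique:
  assumes "is_inverse C A B f g" "is_inverse C A B f h" shows "g = h"
proof -
  have f: "f \<in> Hom C A B" and g: "g \<in> Hom C B A" and h: "h \<in> Hom C B A"
    and eqs: "g \<cdot> f = Ident C A" "f \<cdot> h = Ident C B"
    using assms by (auto simp: is_inverse_def)
  show ?thesis using Comp_assoc[OF h f g] Ident_left[OF h] Ident_right[OF g] eqs by simp
qed

lemma is_inverse_inverse_arrow:
  assumes "is_iso C A B f" shows "is_inverse C A B f (inverse_arrow C A B f)"
proof -
  obtain g where g: "is_inverse C A B f g" using assms by (auto simp: is_iso_def)
  show ?thesis unfolding inverse_arrow_def by (rule theI[of "is_inverse C A B f", OF g]) (rule is_inverse_unique[OF _ g])
qed

end

text \<open>
  An arrow does not determine its endpoints. Carrying them along makes source and target functions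
  of the arrow, so that all typing side conditions of the category laws become decidable by
  simplification.
\<close>

type_synonym ('o, 'a) typed_arrow = "'o \<times> 'a \<times> 'o"

definition typed :: "'o \<Rightarrow> 'a \<Rightarrow> 'o \<Rightarrow> ('o, 'a) typed_arrow" ("\<langle>_, _, _\<rangle>") where
  "typed A f B = (A, f, B)"

definition src :: "('o, 'a) typed_arrow \<Rightarrow> 'o" where "src t = fst t"

definition tgt :: "('o, 'a) typed_arrow \<Rightarrow> 'o" where "tgt t = snd (snd t)"

definition und :: "('o, 'a) typed_arrow \<Rightarrow> 'a" where "und t = fst (snd t)"

lemma typed_sel [simp]: "src \<langle>A, f, B\<rangle> = A" "tgt \<langle>A, f, B\<rangle> = B" "und \<langle>A, f, B\<rangle> = f"
  by (simp_all add: typed_def src_def tgt_def und_def)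

lemma typed_eq_iff [simp]: "\<langle>A, f, B\<rangle> = \<langle>A', f', B'\<rangle> \<longleftrightarrow> A = A' \<and> f = f' \<and> B = B'"
  by (auto simp: typed_def)

lemma typed_collapse: "\<langle>src t, und t, tgt t\<rangle> = t"
  by (simp add: typed_def src_def tgt_def und_def)

section \<open>Composition, tensor product and coherence isomorphisms for typed arrows\<close>

context monoidal_category begin

definition arr :: "('a, 'b) typed_arrow \<Rightarrow> bool" where
  "arr t \<longleftrightarrow> und t \<in> Hom M (src t) (tgt t)"

definition cmp :: "('a, 'b) typed_arrow \<Rightarrow> ('a, 'b) typed_arrow \<Rightarrow> ('a, 'b) typed_arrow"  (infixr "\<bullet>" 70)
  where "g \<bullet> f = \<langle>src f, und g \<cdot> und f, tgt g\<rangle>"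

definition tns :: "('a, 'b) typed_arrow \<Rightarrow> ('a, 'b) typed_arrow \<Rightarrow> ('a, 'b) typed_arrow"  (infixl "\<boxtimes>" 75)
  where "f \<boxtimes> g = \<langle>src f \<otimes> src g, und f \<otimes>\<^sub>a und g, tgt f \<otimes> tgt g\<rangle>"

definition one :: "'a \<Rightarrow> ('a, 'b) typed_arrow" ("\<one>") where "\<one> A = \<langle>A, Ident M A, A\<rangle>"

definition assoc :: "'a \<Rightarrow> 'a \<Rightarrow> 'a \<Rightarrow> ('a, 'b) typed_arrow" ("\<a>")
  where "\<a> A B D = \<langle>(A \<otimes> B) \<otimes> D, Assoc M A B D, A \<otimes> (B \<otimes> D)\<rangle>"

abbreviation Assoc_inv :: "'a \<Rightarrow> 'a \<Rightarrow> 'a \<Rightarrow> 'b"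
  where "Assoc_inv A B D \<equiv> inverse_arrow M ((A \<otimes> B) \<otimes> D) (A \<otimes> (B \<otimes> D)) (Assoc M A B D)"

definition assoc_inv :: "'a \<Rightarrow> 'a \<Rightarrow> 'a \<Rightarrow> ('a, 'b) typed_arrow" ("\<b>")
  where "\<b> A B D = \<langle>A \<otimes> (B \<otimes> D), Assoc_inv A B D, (A \<otimes> B) \<otimes> D\<rangle>"

definition lunit :: "'a \<Rightarrow> ('a, 'b) typed_arrow" ("\<l>")
  where "\<l> A = \<langle>MUnit M \<otimes> A, LUnit M A, A\<rangle>"

definition runit :: "'a \<Rightarrow> ('a, 'b) typed_arrow" ("\<r>")
  where "\<r> A = \<langle>A \<otimes> MUnit M, RUnit M A, A\<rangle>"

lemmas typed_arrow_defs = cmp_def tns_def one_def assoc_def assoc_inv_def lunit_def runit_def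

lemma src_tgt [simp]:
  "src (g \<bullet> f) = src f" "tgt (g \<bullet> f) = tgt g"
  "src (f \<boxtimes> g) = src f \<otimes> src g" "tgt (f \<boxtimes> g) = tgt f \<otimes> tgt g"
  "src (\<one> A) = A" "tgt (\<one> A) = A"
  "src (\<a> A B D) = (A \<otimes> B) \<otimes> D" "tgt (\<a> A B D) = A \<otimes> (B \<otimes> D)"
  "src (\<b> A B D) = A \<otimes> (B \<otimes> D)" "tgt (\<b> A B D) = (A \<otimes> B) \<otimes> D"
  "src (\<l> A) = MUnit M \<otimes> A" "tgt (\<l> A) = A"
  "src (\<r> A) = A \<otimes> MUnit M" "tgt (\<r> A) = A"
  by (simp_all add: typed_arrow_defs)

lemmas [simp] = Tensor_Obj MUnit_Obj

lemma arr_Obj: "arr f \<Longrightarrow> src f \<in> Obj M" "arr f \<Longrightarrow> tgt f \<in> Obj M"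
  unfolding arr_def by (blast dest: Hom_Obj1 Hom_Obj2)+

lemma Assoc_Hom:
  "\<lbrakk>A \<in> Obj M; B \<in> Obj M; D \<in> Obj M\<rbrakk> \<Longrightarrow> Assoc M A B D \<in> Hom M ((A \<otimes> B) \<otimes> D) (A \<otimes> (B \<otimes> D))"
  using Assoc_iso unfolding is_iso_def is_inverse_def by blast

lemma LUnit_Hom: "A \<in> Obj M \<Longrightarrow> LUnit M A \<in> Hom M (MUnit M \<otimes> A) A"
  using LUnit_iso unfolding is_iso_def is_inverse_def by blast

lemma RUnit_Hom: "A \<in> Obj M \<Longrightarrow> RUnit M A \<in> Hom M (A \<otimes> MUnit M) A"
  using RUnit_iso unfolding is_iso_def is_inverse_def by blast

lemma Assoc_inv:
  assumes "A \<in> Obj M" "B \<in> Obj M" "D \<in> Obj M"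
  shows "Assoc_inv A B D \<in> Hom M (A \<otimes> (B \<otimes> D)) ((A \<otimes> B) \<otimes> D)"
    "Assoc_inv A B D \<cdot> Assoc M A B D = Ident M ((A \<otimes> B) \<otimes> D)"
    "Assoc M A B D \<cdot> Assoc_inv A B D = Ident M (A \<otimes> (B \<otimes> D))"
  using is_inverse_inverse_arrow[OF Assoc_iso[OF assms]] unfolding is_inverse_def by blast+

lemma arr_simps [simp]:
  "arr \<langle>A, p, B\<rangle> \<longleftrightarrow> p \<in> Hom M A B"
  "\<lbrakk>arr f; arr g; src g = tgt f\<rbrakk> \<Longrightarrow> arr (g \<bullet> f)"
  "\<lbrakk>arr f; arr g\<rbrakk> \<Longrightarrow> arr (f \<boxtimes> g)"
  "A \<in> Obj M \<Longrightarrow> arr (\<one> A)"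
  "\<lbrakk>A \<in> Obj M; B \<in> Obj M; D \<in> Obj M\<rbrakk> \<Longrightarrow> arr (\<a> A B D)"
  "\<lbrakk>A \<in> Obj M; B \<in> Obj M; D \<in> Obj M\<rbrakk> \<Longrightarrow> arr (\<b> A B D)"
  "A \<in> Obj M \<Longrightarrow> arr (\<l> A)"
  "A \<in> Obj M \<Longrightarrow> arr (\<r> A)"
  by (auto simp: arr_def typed_arrow_defs Assoc_inv intro: Comp_Hom TensorArr_Hom Ident_Hom Assoc_Hom LUnit_Hom RUnit_Hom)

lemma cmp_assoc [simp]:
  "\<lbrakk>arr f; arr g; arr h; src g = tgt f; src h = tgt g\<rbrakk> \<Longrightarrow> (h \<bullet> g) \<bullet> f = h \<bullet> (g \<bullet> f)"
  by (auto simp: arr_def cmp_def intro!: Comp_assoc)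

lemma cmp_one [simp]:
  "\<lbrakk>arr f; tgt f = A\<rbrakk> \<Longrightarrow> \<one> A \<bullet> f = f"
  "\<lbrakk>arr f; src f = A\<rbrakk> \<Longrightarrow> f \<bullet> \<one> A = f"
  using typed_collapse[of f] Ident_left[of "und f"] Ident_right[of "und f"]
  by (auto simp: arr_def cmp_def one_def)

lemma tns_one [simp]: "\<lbrakk>A \<in> Obj M; B \<in> Obj M\<rbrakk> \<Longrightarrow> \<one> A \<boxtimes> \<one> B = \<one> (A \<otimes> B)"
  by (simp add: typed_arrow_defs TensorArr_Ident)

lemma tns_cmp:
  "\<lbrakk>arr f; arr f'; arr g; arr g'; src f' = tgt f; src g' = tgt g\<rbrakk> \<Longrightarrow>
    (f' \<boxtimes> g') \<bullet> (f \<boxtimes> g) = (f' \<bullet> f) \<boxtimes> (g' \<bullet> g)"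
  using TensorArr_Comp[of "und f" "src f" "tgt f" "und f'" "tgt f'" "und g" "src g" "tgt g" "und g'" "tgt g'"]
  by (auto simp: arr_def cmp_def tns_def)

lemma whisker_left: "\<lbrakk>arr f; arr g; src g = tgt f; A \<in> Obj M\<rbrakk> \<Longrightarrow> \<one> A \<boxtimes> (g \<bullet> f) = (\<one> A \<boxtimes> g) \<bullet> (\<one> A \<boxtimes> f)"
  by (simp add: tns_cmp)

lemma whisker_right: "\<lbrakk>arr f; arr g; src g = tgt f; A \<in> Obj M\<rbrakk> \<Longrightarrow> (g \<bullet> f) \<boxtimes> \<one> A = (g \<boxtimes> \<one> A) \<bullet> (f \<boxtimes> \<one> A)"
  by (simp add: tns_cmp)

lemma assoc_inv_cmp [simp]:
  "\<lbrakk>A \<in> Obj M; B \<in> Obj M; D \<in> Obj M\<rbrakk> \<Longrightarrow> \<a> A B D \<bullet> \<b> A B D = \<one> (A \<otimes> (B \<otimes> D))"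
  "\<lbrakk>A \<in> Obj M; B \<in> Obj M; D \<in> Obj M\<rbrakk> \<Longrightarrow> \<b> A B D \<bullet> \<a> A B D = \<one> ((A \<otimes> B) \<otimes> D)"
  by (simp_all add: typed_arrow_defs Assoc_inv)

lemma assoc_nat:
  "\<lbrakk>arr f; arr g; arr h; tgt f = A; tgt g = B; tgt h = D\<rbrakk> \<Longrightarrow>
    \<a> A B D \<bullet> ((f \<boxtimes> g) \<boxtimes> h) = (f \<boxtimes> (g \<boxtimes> h)) \<bullet> \<a> (src f) (src g) (src h)"
  using Assoc_natural[of "und f" "src f" "tgt f" "und g" "src g" "tgt g" "und h" "src h" "tgt h"]
  by (auto simp: arr_def typed_arrow_defs)

lemma assoc_nat_right:
  "\<lbrakk>A \<in> Obj M; B \<in> Obj M; arr h; tgt h = D\<rbrakk> \<Longrightarrow>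
    \<a> A B D \<bullet> (\<one> (A \<otimes> B) \<boxtimes> h) = (\<one> A \<boxtimes> (\<one> B \<boxtimes> h)) \<bullet> \<a> A B (src h)"
  using assoc_nat[of "\<one> A" "\<one> B" h A B D] by simp

lemma assoc_nat_left:
  "\<lbrakk>A \<in> Obj M; B \<in> Obj M; arr h; tgt h = D\<rbrakk> \<Longrightarrow>
    \<a> D A B \<bullet> ((h \<boxtimes> \<one> A) \<boxtimes> \<one> B) = (h \<boxtimes> \<one> (A \<otimes> B)) \<bullet> \<a> (src h) A B"
  using assoc_nat[of h "\<one> A" "\<one> B" D A B] by simp

lemma lunit_nat: "\<lbrakk>arr f; tgt f = A\<rbrakk> \<Longrightarrow> \<l> A \<bullet> (\<one> (MUnit M) \<boxtimes> f) = f \<bullet> \<l> (src f)"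
  using LUnit_natural[of "und f" "src f" "tgt f"] by (auto simp: arr_def typed_arrow_defs)

lemma runit_nat: "\<lbrakk>arr f; tgt f = A\<rbrakk> \<Longrightarrow> \<r> A \<bullet> (f \<boxtimes> \<one> (MUnit M)) = f \<bullet> \<r> (src f)"
  using RUnit_natural[of "und f" "src f" "tgt f"] by (auto simp: arr_def typed_arrow_defs)

lemma assoc_pentagon:
  "\<lbrakk>A \<in> Obj M; B \<in> Obj M; D \<in> Obj M; E \<in> Obj M\<rbrakk> \<Longrightarrow>
    (\<one> A \<boxtimes> \<a> B D E) \<bullet> \<a> A (B \<otimes> D) E \<bullet> (\<a> A B D \<boxtimes> \<one> E) = \<a> A B (D \<otimes> E) \<bullet> \<a> (A \<otimes> B) D E"
  using pentagon[of A B D E] by (simp add: typed_arrow_defs)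

lemma assoc_triangle:
  "\<lbrakk>A \<in> Obj M; B \<in> Obj M\<rbrakk> \<Longrightarrow> (\<one> A \<boxtimes> \<l> B) \<bullet> \<a> A (MUnit M) B = \<r> A \<boxtimes> \<one> B"
  using triangle[of A B] by (simp add: typed_arrow_defs)

text \<open>Composites are normalised by nesting to the right, so an equation
  \<open>a \<bullet> b = c\<close> matches literally only at the end of a chain. This form applies
  it in front of a further factor \<open>t\<close>.\<close>

lemma tail: "\<lbrakk>a \<bullet> b = c; arr a; arr b; arr t; src a = tgt b; src b = tgt t\<rbrakk> \<Longrightarrow> a \<bullet> (b \<bullet> t) = c \<bullet> t"
  by (metis cmp_assoc)

text \<open>Both sides are \<open>f \<boxtimes> g\<close>, by functoriality of the tensor
  product.\<close>

lemma interchange: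
  "\<lbrakk>arr f; arr g; src f = A; tgt f = A'; src g = B; tgt g = B'\<rbrakk> \<Longrightarrow>
    (f \<boxtimes> \<one> B') \<bullet> (\<one> A \<boxtimes> g) = (\<one> A' \<boxtimes> g) \<bullet> (f \<boxtimes> \<one> B)"
  using arr_Obj[of f] arr_Obj[of g] by (auto simp: tns_cmp)

section \<open>Cancellation of split arrows and faithfulness of tensoring with the unit\<close>

lemma lunit_section: "A \<in> Obj M \<Longrightarrow> \<exists>i. arr i \<and> src i = A \<and> tgt i = MUnit M \<otimes> A \<and> \<l> A \<bullet> i = \<one> A"
proof -
  assume "A \<in> Obj M"
  then obtain i where "i \<in> Hom M A (MUnit M \<otimes> A)" "LUnit M A \<cdot> i = Ident M A"
    using LUnit_iso unfolding is_iso_def is_inverse_def by blast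
  then show ?thesis by (intro exI[of _ "\<langle>A, i, MUnit M \<otimes> A\<rangle>"]) (simp add: typed_arrow_defs)
qed

lemma runit_section: "A \<in> Obj M \<Longrightarrow> \<exists>i. arr i \<and> src i = A \<and> tgt i = A \<otimes> MUnit M \<and> \<r> A \<bullet> i = \<one> A"
proof -
  assume "A \<in> Obj M"
  then obtain i where "i \<in> Hom M A (A \<otimes> MUnit M)" "RUnit M A \<cdot> i = Ident M A"
    using RUnit_iso unfolding is_iso_def is_inverse_def by blast
  then show ?thesis by (intro exI[of _ "\<langle>A, i, A \<otimes> MUnit M\<rangle>"]) (simp add: typed_arrow_defs)
qed

text \<open>Precompose with the section \<open>i\<close>: a split epimorphism is epi.\<close>

lemma section_cancel:
  assumes "f \<bullet> p = g \<bullet> p" "p \<bullet> i = \<one> A" "arr f" "arr g" "arr p" "arr i" "tgt i = src p" "src f = A" "src g = A" "tgt p = A"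
  shows "f = g"
proof -
  have "f \<bullet> (p \<bullet> i) = g \<bullet> (p \<bullet> i)"
    using assms tail[of f p "g \<bullet> p" i] by simp
  then show ?thesis using assms by simp
qed

text \<open>Postcompose with the retraction \<open>i\<close>: a split monomorphism is mono.\<close>

lemma retraction_cancel:
  assumes "p \<bullet> f = p \<bullet> g" "i \<bullet> p = \<one> A" "arr f" "arr g" "arr p" "arr i" "src i = tgt p" "tgt f = A" "tgt g = A" "src p = A"
  shows "f = g"
proof -
  have "\<one> A \<bullet> f = i \<bullet> (p \<bullet> f)" "\<one> A \<bullet> g = i \<bullet> (p \<bullet> g)"
    by (rule tail[symmetric]; use assms(2-) in simp)+
  then show ?thesis using assms(1,3,4,8,9) by simp
qed

text \<open>By naturality of \<open>\<l>\<close>, the tensored arrow determines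
  \<open>f \<bullet> \<l> (src f)\<close>, and \<open>\<l>\<close> has a section, so it can be
  cancelled.\<close>

lemma unit_left_faithful:
  assumes "\<one> (MUnit M) \<boxtimes> f = \<one> (MUnit M) \<boxtimes> g" "arr f" "arr g" "src f = src g" "tgt f = tgt g"
  shows "f = g"
proof -
  obtain i where i: "arr i" "src i = src f" "tgt i = MUnit M \<otimes> src f" "\<l> (src f) \<bullet> i = \<one> (src f)"
    using lunit_section[OF arr_Obj(1)[OF assms(2)]] by blast
  have "f \<bullet> \<l> (src f) = g \<bullet> \<l> (src f)"
    using lunit_nat[of f "tgt f"] lunit_nat[of g "tgt g"] assms by simp
  then show ?thesis
    by (rule section_cancel[OF _ i(4)]) (use assms i arr_Obj[OF assms(2)] in simp_all)
qed

lemma unit_right_faithful: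
  assumes "f \<boxtimes> \<one> (MUnit M) = g \<boxtimes> \<one> (MUnit M)" "arr f" "arr g" "src f = src g" "tgt f = tgt g"
  shows "f = g"
proof -
  obtain i where i: "arr i" "src i = src f" "tgt i = src f \<otimes> MUnit M" "\<r> (src f) \<bullet> i = \<one> (src f)"
    using runit_section[OF arr_Obj(1)[OF assms(2)]] by blast
  have "f \<bullet> \<r> (src f) = g \<bullet> \<r> (src f)"
    using runit_nat[of f "tgt f"] runit_nat[of g "tgt g"] assms by simp
  then show ?thesis
    by (rule section_cancel[OF _ i(4)]) (use assms i arr_Obj[OF assms(2)] in simp_all)
qed

text \<open>The two unit laws below are Kelly's consequences of the pentagon and the triangle.\<close>

lemma lunit_tns:
  assumes [simp]: "A \<in> Obj M" "B \<in> Obj M"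
  shows "\<l> (A \<otimes> B) \<bullet> \<a> (MUnit M) A B = \<l> A \<boxtimes> \<one> B"
proof -
  let ?I = "MUnit M"
  \<comment> \<open>The equation is proved after tensoring with the unit on the left and
    precomposing with the isomorphism \<open>?p\<close>. In this form the pentagon and the triangle
    apply; \<open>?p\<close> is then cancelled through \<open>?i\<close>, and the unit by
    \<open>unit_left_faithful\<close>.\<close>
  let ?p = "\<a> ?I (?I \<otimes> A) B \<bullet> (\<a> ?I ?I A \<boxtimes> \<one> B)"
  let ?i = "(\<b> ?I ?I A \<boxtimes> \<one> B) \<bullet> \<b> ?I (?I \<otimes> A) B"
  have eq: "(\<one> ?I \<boxtimes> (\<l> (A \<otimes> B) \<bullet> \<a> ?I A B)) \<bullet> ?p = (\<one> ?I \<boxtimes> (\<l> A \<boxtimes> \<one> B)) \<bullet> ?p" (is "?L = ?R")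
  proof -
    have "?L = (\<one> ?I \<boxtimes> \<l> (A \<otimes> B)) \<bullet> \<a> ?I ?I (A \<otimes> B) \<bullet> \<a> (?I \<otimes> ?I) A B"
      by (simp add: whisker_left assoc_pentagon)
    also have "\<dots> = (\<r> ?I \<boxtimes> \<one> (A \<otimes> B)) \<bullet> \<a> (?I \<otimes> ?I) A B"
      by (simp add: tail[OF assoc_triangle])
    also have "\<dots> = \<a> ?I A B \<bullet> ((\<r> ?I \<boxtimes> \<one> A) \<boxtimes> \<one> B)"
      by (simp add: assoc_nat_left)
    also have "\<dots> = ?R"
      by (simp add: assoc_triangle[symmetric] whisker_right tail[OF assoc_nat])
    finally show ?thesis .
  qed
  have "(\<a> ?I ?I A \<boxtimes> \<one> B) \<bullet> (\<b> ?I ?I A \<boxtimes> \<one> B) = \<one> (?I \<otimes> (?I \<otimes> A) \<otimes> B)"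
    by (simp add: tns_cmp)
  from tail[OF this] have i: "?p \<bullet> ?i = \<one> (?I \<otimes> ((?I \<otimes> A) \<otimes> B))"
    by simp
  have "\<one> ?I \<boxtimes> (\<l> (A \<otimes> B) \<bullet> \<a> ?I A B) = \<one> ?I \<boxtimes> (\<l> A \<boxtimes> \<one> B)"
    by (rule section_cancel[OF eq i]) simp_all
  then show ?thesis by (rule unit_left_faithful) simp_all
qed

lemma runit_tns:
  assumes [simp]: "A \<in> Obj M" "B \<in> Obj M"
  shows "(\<one> A \<boxtimes> \<r> B) \<bullet> \<a> A B (MUnit M) = \<r> (A \<otimes> B)"
proof -
  let ?I = "MUnit M"
  \<comment> \<open>The mirror image of the preceding argument: both sides are tensored with the
    unit on the right and followed by an associator, which is cancelled at the end.\<close>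
  have "\<a> A B ?I \<bullet> (((\<one> A \<boxtimes> \<r> B) \<bullet> \<a> A B ?I) \<boxtimes> \<one> ?I)
      = (\<one> A \<boxtimes> (\<r> B \<boxtimes> \<one> ?I)) \<bullet> \<a> A (B \<otimes> ?I) ?I \<bullet> (\<a> A B ?I \<boxtimes> \<one> ?I)"
    by (simp add: whisker_right tail[OF assoc_nat])
  also have "\<dots> = (\<one> A \<boxtimes> (\<one> B \<boxtimes> \<l> ?I)) \<bullet> (\<one> A \<boxtimes> \<a> B ?I ?I) \<bullet> \<a> A (B \<otimes> ?I) ?I \<bullet> (\<a> A B ?I \<boxtimes> \<one> ?I)"
    by (simp add: assoc_triangle[of B ?I, symmetric] whisker_left)
  also have "\<dots> = (\<one> A \<boxtimes> (\<one> B \<boxtimes> \<l> ?I)) \<bullet> \<a> A B (?I \<otimes> ?I) \<bullet> \<a> (A \<otimes> B) ?I ?I"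
    by (simp add: assoc_pentagon)
  also have "\<dots> = \<a> A B ?I \<bullet> (\<one> (A \<otimes> B) \<boxtimes> \<l> ?I) \<bullet> \<a> (A \<otimes> B) ?I ?I"
    by (simp add: tail[OF assoc_nat_right])
  also have "\<dots> = \<a> A B ?I \<bullet> (\<r> (A \<otimes> B) \<boxtimes> \<one> ?I)"
    by (simp add: assoc_triangle)
  finally have "((\<one> A \<boxtimes> \<r> B) \<bullet> \<a> A B ?I) \<boxtimes> \<one> ?I = \<r> (A \<otimes> B) \<boxtimes> \<one> ?I"
    by (rule retraction_cancel[OF _ assoc_inv_cmp(2)]) simp_all
  then show ?thesis by (rule unit_right_faithful) simp_all
qed

end

section \<open>Equalizers and coequalizers\<close>

text \<open>The arrows \<open>0\<close> and \<open>1\<close> are the parallel pair; \<open>2\<close> is the identity of either object.\<close>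

definition parallel_pair :: "(nat, nat) category" where
  "parallel_pair = \<lparr>Obj = {0, 1},
     Hom = (\<lambda>i j. if i = j \<and> i \<in> {0, 1} then {2} else if i = 0 \<and> j = 1 then {0, 1} else {}),
     Ident = (\<lambda>_. 2),
     Comp = (\<lambda>g f. if g = 2 then f else g)\<rparr>"

definition parallel_diagram ::
  "('o, 'a, 'x) category_scheme \<Rightarrow> 'o \<Rightarrow> 'o \<Rightarrow> 'a \<Rightarrow> 'a \<Rightarrow> (nat, nat, 'o, 'a) functor_data" where
  "parallel_diagram C A B f g = \<lparr>fobj = (\<lambda>i. if i = 0 then A else B),
     farr = (\<lambda>i j u. if u = 2 then Ident C (if i = 0 then A else B) else if u = 0 then f else g)\<rparr>"

lemma parallel_pair_sel [simp]:
  "Obj parallel_pair = {0, 1}"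
  "Hom parallel_pair i j = (if i = j \<and> i \<in> {0, 1} then {2} else if i = 0 \<and> j = 1 then {0, 1} else {})"
  "Ident parallel_pair i = 2"
  "g \<cdot>\<^bsub>parallel_pair\<^esub> f = (if g = 2 then f else g)"
  by (simp_all add: parallel_pair_def)

lemma parallel_diagram_sel [simp]:
  "fobj (parallel_diagram C A B f g) i = (if i = 0 then A else B)"
  "farr (parallel_diagram C A B f g) i j u =
     (if u = 2 then Ident C (if i = 0 then A else B) else if u = 0 then f else g)"
  by (simp_all add: parallel_diagram_def)

lemma finite_category_parallel_pair: "is_finite_category parallel_pair"
  unfolding is_finite_category_def category_def by (simp split: if_splits)

context category begin

lemma functor_parallel_diagram:
  assumes f: "f \<in> Hom C A B" and g: "g \<in> Hom C A B"
  shows "is_functor parallel_pair C (parallel_diagram C A B f g)"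
proof -
  note [simp] = Hom_Obj1[OF f] Hom_Obj2[OF f] f g Ident_left[OF f] Ident_left[OF g]
    Ident_right[OF f] Ident_right[OF g]
  have "category parallel_pair"
    using finite_category_parallel_pair by (simp add: is_finite_category_def)
  moreover have "category C" by (rule category_axioms)
  moreover have "Ident C A \<cdot> Ident C A = Ident C A" "Ident C B \<cdot> Ident C B = Ident C B"
    by (rule Ident_left, rule Ident_Hom, simp)+
  ultimately show ?thesis
    by (auto simp: is_functor_def Ident_Hom split: if_splits)
qed

text \<open>An equalizer is a limit over the parallel pair: a cone is determined by its component at
  \<open>0\<close>, since the one at \<open>1\<close> must be \<open>f \<cdot> p 0\<close>, and
  commutation with the second arrow is the equalizing condition.\<close>

lemma equalizer_ex:
  assumes "has_finite_limits C" and f: "f \<in> Hom C A B" and g: "g \<in> Hom C A B"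
  shows "\<exists>K k. is_equalizer C A B f g K k"
proof -
  let ?D = "parallel_diagram C A B f g"
  note [simp] = Hom_Obj1[OF f] Hom_Obj2[OF f]
  have cone: "is_cone parallel_pair C ?D L p \<longleftrightarrow>
      p 0 \<in> Hom C L A \<and> p 1 = f \<cdot> p 0 \<and> f \<cdot> p 0 = g \<cdot> p 0" for L p
  proof -
    have "is_cone parallel_pair C ?D L p \<longleftrightarrow> L \<in> Obj C \<and> p 0 \<in> Hom C L A \<and> p 1 \<in> Hom C L B \<and>
        Ident C A \<cdot> p 0 = p 0 \<and> Ident C B \<cdot> p 1 = p 1 \<and> f \<cdot> p 0 = p 1 \<and> g \<cdot> p 0 = p 1"
      by (auto simp: is_cone_def)
    then show ?thesis
      using Comp_Hom[OF _ f, of "p 0" L] Hom_Obj1[of "p 0" L A]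
        Ident_left[of "p 0" L A] Ident_left[of "p 1" L B] by auto
  qed
  obtain L p where lim: "is_limit parallel_pair C ?D L p"
    using assms finite_category_parallel_pair functor_parallel_diagram[OF f g]
    unfolding has_finite_limits_def by blast
  have "is_cone parallel_pair C ?D L p"
    using lim unfolding is_limit_def by blast
  then have p: "p 0 \<in> Hom C L A" "p 1 = f \<cdot> p 0" "f \<cdot> p 0 = g \<cdot> p 0"
    unfolding cone by blast+
  have univ: "\<And>L' p'. is_cone parallel_pair C ?D L' p' \<Longrightarrow>
        \<exists>!h. h \<in> Hom C L' L \<and> (\<forall>j\<in>Obj parallel_pair. p j \<cdot> h = p' j)"
    using lim unfolding is_limit_def by blast
  have "\<exists>!u. u \<in> Hom C Z L \<and> p 0 \<cdot> u = h" if h: "h \<in> Hom C Z A" "f \<cdot> h = g \<cdot> h" for Z h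
  proof -
    have "\<exists>!u. u \<in> Hom C Z L \<and> (\<forall>j\<in>Obj parallel_pair. p j \<cdot> u = (if j = 0 then h else f \<cdot> h))"
      by (rule univ) (simp add: cone h)
    \<comment> \<open>The condition at \<open>1\<close> follows from the one at \<open>0\<close>,
      because \<open>p 1 = f \<cdot> p 0\<close>.\<close>
    moreover have "(u \<in> Hom C Z L \<and> (\<forall>j\<in>Obj parallel_pair. p j \<cdot> u = (if j = 0 then h else f \<cdot> h)))
        \<longleftrightarrow> u \<in> Hom C Z L \<and> p 0 \<cdot> u = h" for u
      using Comp_assoc[OF _ p(1) f, of u Z] p(2) by auto
    ultimately show ?thesis by simp
  qed
  then show ?thesis using p f g unfolding is_equalizer_def by blast
qed

text \<open>Dual to \<open>equalizer_ex\<close>: a cocone is determined by its component at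
  \<open>1\<close>, since the one at \<open>0\<close> must be \<open>p 1 \<cdot> f\<close>.\<close>

lemma coequalizer_ex:
  assumes "has_finite_colimits C" and f: "f \<in> Hom C A B" and g: "g \<in> Hom C A B"
  shows "\<exists>Q q. is_coequalizer C A B f g Q q"
proof -
  let ?D = "parallel_diagram C A B f g"
  note [simp] = Hom_Obj1[OF f] Hom_Obj2[OF f]
  have cocone: "is_cocone parallel_pair C ?D L p \<longleftrightarrow>
      p 1 \<in> Hom C B L \<and> p 0 = p 1 \<cdot> f \<and> p 1 \<cdot> f = p 1 \<cdot> g" for L p
  proof -
    have "is_cocone parallel_pair C ?D L p \<longleftrightarrow> L \<in> Obj C \<and> p 0 \<in> Hom C A L \<and> p 1 \<in> Hom C B L \<and>
        p 0 \<cdot> Ident C A = p 0 \<and> p 1 \<cdot> Ident C B = p 1 \<and> p 1 \<cdot> f = p 0 \<and> p 1 \<cdot> g = p 0"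
      by (auto simp: is_cocone_def)
    then show ?thesis
      using Comp_Hom[OF f, of "p 1" L] Hom_Obj2[of "p 1" B L]
        Ident_right[of "p 0" A L] Ident_right[of "p 1" B L] by auto
  qed
  obtain L p where lim: "is_colimit parallel_pair C ?D L p"
    using assms finite_category_parallel_pair functor_parallel_diagram[OF f g]
    unfolding has_finite_colimits_def by blast
  have "is_cocone parallel_pair C ?D L p"
    using lim unfolding is_colimit_def by blast
  then have p: "p 1 \<in> Hom C B L" "p 0 = p 1 \<cdot> f" "p 1 \<cdot> f = p 1 \<cdot> g"
    unfolding cocone by blast+
  have univ: "\<And>L' p'. is_cocone parallel_pair C ?D L' p' \<Longrightarrow>
        \<exists>!h. h \<in> Hom C L L' \<and> (\<forall>j\<in>Obj parallel_pair. h \<cdot> p j = p' j)"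
    using lim unfolding is_colimit_def by blast
  have "\<exists>!u. u \<in> Hom C L Z \<and> u \<cdot> p 1 = h" if h: "h \<in> Hom C B Z" "h \<cdot> f = h \<cdot> g" for Z h
  proof -
    have "\<exists>!u. u \<in> Hom C L Z \<and> (\<forall>j\<in>Obj parallel_pair. u \<cdot> p j = (if j = 0 then h \<cdot> f else h))"
      by (rule univ) (simp add: cocone h)
    moreover have "(u \<in> Hom C L Z \<and> (\<forall>j\<in>Obj parallel_pair. u \<cdot> p j = (if j = 0 then h \<cdot> f else h)))
        \<longleftrightarrow> u \<in> Hom C L Z \<and> u \<cdot> p 1 = h" for u
      using Comp_assoc[OF f p(1), of u Z] p(2) by auto
    ultimately show ?thesis by simp
  qed
  then show ?thesis using p f g unfolding is_coequalizer_def by blast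
qed

section \<open>The chosen equalizers and coequalizers, and cancellation of their structure
  maps\<close>

lemma is_equalizer_equalizer:
  assumes "has_finite_limits C" "f \<in> Hom C A B" "g \<in> Hom C A B"
  shows "is_equalizer C A B f g (fst (equalizer C A B f g)) (snd (equalizer C A B f g))"
proof -
  have "case equalizer C A B f g of (K, k) \<Rightarrow> is_equalizer C A B f g K k"
    unfolding equalizer_def by (rule someI_ex) (use equalizer_ex[OF assms] in auto)
  then show ?thesis by (simp add: case_prod_beta)
qed

lemma is_coequalizer_coequalizer:
  assumes "has_finite_colimits C" "f \<in> Hom C A B" "g \<in> Hom C A B"
  shows "is_coequalizer C A B f g (fst (coequalizer C A B f g)) (snd (coequalizer C A B f g))"
proof -
  have "case coequalizer C A B f g of (Q, q) \<Rightarrow> is_coequalizer C A B f g Q q"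
    unfolding coequalizer_def by (rule someI_ex) (use coequalizer_ex[OF assms] in auto)
  then show ?thesis by (simp add: case_prod_beta)
qed

text \<open>Both \<open>u\<close> and \<open>v\<close> factor the map \<open>u \<cdot> q\<close>,
  which coequalizes \<open>f\<close> and \<open>g\<close>; the universal property allows only one
  factorization.\<close>

lemma coequalizer_cancel:
  assumes "is_coequalizer C A B f g Q q" "u \<in> Hom C Q Z" "v \<in> Hom C Q Z" "u \<cdot> q = v \<cdot> q"
  shows "u = v"
proof -
  have f: "f \<in> Hom C A B" and g: "g \<in> Hom C A B" and q: "q \<in> Hom C B Q" and fg: "q \<cdot> f = q \<cdot> g"
    and univ: "\<And>Z h. h \<in> Hom C B Z \<Longrightarrow> h \<cdot> f = h \<cdot> g \<Longrightarrow> \<exists>!u. u \<in> Hom C Q Z \<and> u \<cdot> q = h"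
    using assms(1) unfolding is_coequalizer_def by blast+
  have "\<exists>!w. w \<in> Hom C Q Z \<and> w \<cdot> q = u \<cdot> q"
    by (rule univ) (use assms(2) Comp_Hom q f g fg in \<open>auto simp: Comp_assoc[OF f q] Comp_assoc[OF g q]\<close>)
  then show ?thesis using assms(2-4) by auto
qed

lemma equalizer_cancel:
  assumes "is_equalizer C A B f g K k" "u \<in> Hom C Z K" "v \<in> Hom C Z K" "k \<cdot> u = k \<cdot> v"
  shows "u = v"
proof -
  have f: "f \<in> Hom C A B" and g: "g \<in> Hom C A B" and k: "k \<in> Hom C K A" and fg: "f \<cdot> k = g \<cdot> k"
    and univ: "\<And>Z h. h \<in> Hom C Z A \<Longrightarrow> f \<cdot> h = g \<cdot> h \<Longrightarrow> \<exists>!u. u \<in> Hom C Z K \<and> k \<cdot> u = h"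
    using assms(1) unfolding is_equalizer_def by blast+
  have "f \<cdot> (k \<cdot> u) = g \<cdot> (k \<cdot> u)"
    using Comp_assoc[OF assms(2) k f] Comp_assoc[OF assms(2) k g] fg by simp
  then have "\<exists>!w. w \<in> Hom C Z K \<and> k \<cdot> w = k \<cdot> u"
    using univ Comp_Hom[OF assms(2) k] by blast
  then show ?thesis using assms(2-4) by auto
qed

end

section \<open>The internal hom\<close>

locale closed_smc = closed_symmetric_monoidal_category M
  for M :: "('o, 'a) closed_monoidal_data" (structure)
begin

text \<open>The tensor-hom adjunction in the direction inverse to \<open>transpose\<close>.
  Equations between maps into \<open>IHom\<close> are checked after applying it, where they become
  equations between ordinary composites.\<close>

definition uncurry :: "'o \<Rightarrow> 'o \<Rightarrow> 'a \<Rightarrow> 'a" where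
  "uncurry A B k = Eval M A B \<cdot> (k \<otimes>\<^sub>a Ident M A)"

lemmas [simp] = IHom_Obj

lemma uncurry_Hom:
  "\<lbrakk>k \<in> Hom M Z (IHom M A B); A \<in> Obj M; B \<in> Obj M\<rbrakk> \<Longrightarrow> uncurry A B k \<in> Hom M (Z \<otimes> A) B"
  unfolding uncurry_def by (intro Comp_Hom[OF TensorArr_Hom[OF _ Ident_Hom] Eval_Hom])

lemma transpose:
  assumes "A \<in> Obj M" "B \<in> Obj M" "Z \<in> Obj M" "f \<in> Hom M (Z \<otimes> A) B"
  shows "transpose M A B Z f \<in> Hom M Z (IHom M A B)" "uncurry A B (transpose M A B Z f) = f"
  using theI'[OF Eval_universal[OF assms]] unfolding transpose_def uncurry_def by auto

lemma uncurry_inj: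
  assumes "uncurry A B k = uncurry A B k'" "k \<in> Hom M Z (IHom M A B)" "k' \<in> Hom M Z (IHom M A B)"
    "A \<in> Obj M" "B \<in> Obj M"
  shows "k = k'"
proof -
  have "\<exists>!g. g \<in> Hom M Z (IHom M A B) \<and> uncurry A B g = uncurry A B k"
    using Eval_universal[OF assms(4,5) Hom_Obj1[OF assms(2)] uncurry_Hom[OF assms(2,4,5)]]
    unfolding uncurry_def .
  then show ?thesis using assms(1-3) by auto
qed

text \<open>Naturality of the adjunction in the parameter object; it rests on
  \<open>- \<otimes> A\<close> preserving composition.\<close>

lemma uncurry_natural:
  assumes j: "j \<in> Hom M Z' Z" and k: "k \<in> Hom M Z (IHom M A B)" and [simp]: "A \<in> Obj M" "B \<in> Obj M"
  shows "uncurry A B (k \<cdot> j) = uncurry A B k \<cdot> (j \<otimes>\<^sub>a Ident M A)"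
proof -
  note [simp] = j k Eval_Hom
  let ?e = "\<langle>IHom M A B \<otimes> A, Eval M A B, B\<rangle>"
  let ?j = "\<langle>Z', j, Z\<rangle>" and ?k = "\<langle>Z, k, IHom M A B\<rangle>"
  have "?e \<bullet> ((?k \<bullet> ?j) \<boxtimes> \<one> A) = (?e \<bullet> (?k \<boxtimes> \<one> A)) \<bullet> (?j \<boxtimes> \<one> A)"
    by (simp add: whisker_right)
  then show ?thesis by (simp add: typed_arrow_defs uncurry_def)
qed

text \<open>The existence half of the fact that \<open>- \<otimes> D\<close> preserves coequalizers.
  The transpose \<open>B \<rightarrow> IHom M D Z\<close> of \<open>h\<close> coequalizes
  \<open>f\<close> and \<open>g\<close>, hence factors through \<open>q\<close>; uncurrying the
  factorization gives \<open>u\<close>.\<close>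

lemma tensor_coequalizer_factor:
  assumes q: "is_coequalizer M A B f g Q q" and D: "D \<in> Obj M"
    and h: "h \<in> Hom M (B \<otimes> D) Z" "h \<cdot> (f \<otimes>\<^sub>a Ident M D) = h \<cdot> (g \<otimes>\<^sub>a Ident M D)"
  obtains u where "u \<in> Hom M (Q \<otimes> D) Z" "u \<cdot> (q \<otimes>\<^sub>a Ident M D) = h"
proof -
  have f: "f \<in> Hom M A B" "g \<in> Hom M A B" "q \<in> Hom M B Q"
    and univ: "\<And>Z h. h \<in> Hom M B Z \<Longrightarrow> h \<cdot> f = h \<cdot> g \<Longrightarrow> \<exists>!u. u \<in> Hom M Q Z \<and> u \<cdot> q = h"
    using q unfolding is_coequalizer_def by blast+
  have Z: "Z \<in> Obj M" and B: "B \<in> Obj M" by (rule Hom_Obj2[OF h(1)], rule Hom_Obj2[OF f(1)])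
  let ?h = "transpose M D Z B h"
  note t = transpose[OF D Z B h(1)]
  have "uncurry D Z (?h \<cdot> f) = uncurry D Z (?h \<cdot> g)"
    using uncurry_natural[OF f(1) t(1) D Z] uncurry_natural[OF f(2) t(1) D Z] t(2) h(2) by simp
  from uncurry_inj[OF this Comp_Hom[OF f(1) t(1)] Comp_Hom[OF f(2) t(1)] D Z]
  obtain u where "u \<in> Hom M Q (IHom M D Z)" "u \<cdot> q = ?h" using univ[OF t(1)] by blast
  then show ?thesis
    using that[OF uncurry_Hom[of u Q D Z]] D Z t uncurry_natural[OF f(3), of u D Z] by simp
qed

text \<open>The uniqueness half: the transposes of \<open>u\<close> and \<open>v\<close> agree after
  \<open>q\<close>, hence agree by \<open>coequalizer_cancel\<close>.\<close>

lemma tensor_coequalizer_cancel: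
  assumes q: "is_coequalizer M A B f g Q q" and D: "D \<in> Obj M"
    and u: "u \<in> Hom M (Q \<otimes> D) Z" and v: "v \<in> Hom M (Q \<otimes> D) Z"
    and eq: "u \<cdot> (q \<otimes>\<^sub>a Ident M D) = v \<cdot> (q \<otimes>\<^sub>a Ident M D)"
  shows "u = v"
proof -
  have qH: "q \<in> Hom M B Q" using q unfolding is_coequalizer_def by blast
  have Z: "Z \<in> Obj M" and Q: "Q \<in> Obj M" by (rule Hom_Obj2[OF u], rule Hom_Obj2[OF qH])
  note tu = transpose[OF D Z Q u] and tv = transpose[OF D Z Q v]
  have "transpose M D Z Q u \<cdot> q = transpose M D Z Q v \<cdot> q"
    by (rule uncurry_inj[OF _ Comp_Hom[OF qH tu(1)] Comp_Hom[OF qH tv(1)] D Z])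
      (simp add: uncurry_natural[OF qH tu(1) D Z] uncurry_natural[OF qH tv(1) D Z] tu tv eq)
  from arg_cong[OF coequalizer_cancel[OF q tu(1) tv(1) this], of "uncurry D Z"]
  show ?thesis by (simp only: tu tv)
qed

end

context monoidal_category begin

lemma assoc_inv_nat_left:
  assumes [simp]: "A \<in> Obj M" "B \<in> Obj M" "arr h" "tgt h = D"
  shows "\<b> D A B \<bullet> (h \<boxtimes> \<one> (A \<otimes> B)) = ((h \<boxtimes> \<one> A) \<boxtimes> \<one> B) \<bullet> \<b> (src h) A B"
proof -
  have [simp]: "src h \<in> Obj M" "D \<in> Obj M" using arr_Obj[OF assms(3)] by simp_all
  have *: "\<a> D A B \<bullet> \<b> D A B \<bullet> (h \<boxtimes> \<one> (A \<otimes> B)) = \<one> (D \<otimes> (A \<otimes> B)) \<bullet> (h \<boxtimes> \<one> (A \<otimes> B))"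
    by (rule tail) simp_all
  have "\<a> D A B \<bullet> \<b> D A B \<bullet> (h \<boxtimes> \<one> (A \<otimes> B)) =
      \<a> D A B \<bullet> ((h \<boxtimes> \<one> A) \<boxtimes> \<one> B) \<bullet> \<b> (src h) A B"
    by (simp add: * tail[OF assoc_nat_left])
  then show ?thesis
    by (rule retraction_cancel[OF _ assoc_inv_cmp(2)]) simp_all
qed

end

section \<open>Functoriality, composition and names in the internal hom, seen through the
  adjunction\<close>

context closed_smc begin

text \<open>The definition by \<open>transpose\<close> describes the case where \<open>k\<close> is
  an identity; naturality of \<open>uncurry\<close> extends it to every generalized element
  \<open>k\<close>. The lemma replaces the definition in all later computations.\<close>

lemma uncurry_ihom_map:
  assumes u: "u \<in> Hom M X' X" and v: "v \<in> Hom M Y Y'"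
  shows "ihom_map M X' X Y Y' u v \<in> Hom M (IHom M X Y) (IHom M X' Y')"
    and "k \<in> Hom M Z (IHom M X Y) \<Longrightarrow>
      uncurry X' Y' (ihom_map M X' X Y Y' u v \<cdot> k) = v \<cdot> uncurry X Y k \<cdot> (Ident M Z \<otimes>\<^sub>a u)"
proof -
  note [simp] = u v Hom_Obj1[OF u] Hom_Obj2[OF u] Hom_Obj1[OF v] Hom_Obj2[OF v] Eval_Hom
  let ?H = "IHom M X Y"
  let ?e = "\<langle>?H \<otimes> X, Eval M X Y, Y\<rangle>" and ?u = "\<langle>X', u, X\<rangle>" and ?v = "\<langle>Y, v, Y'\<rangle>"
  have "arr (?v \<bullet> ?e \<bullet> (\<one> ?H \<boxtimes> ?u))" by simp
  then have "v \<cdot> Eval M X Y \<cdot> (Ident M ?H \<otimes>\<^sub>a u) \<in> Hom M (?H \<otimes> X') Y'"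
    by (simp add: typed_arrow_defs)
  note t = transpose[OF _ _ _ this, folded ihom_map_def, simplified]
  show "ihom_map M X' X Y Y' u v \<in> Hom M ?H (IHom M X' Y')" by (rule t)
  show "uncurry X' Y' (ihom_map M X' X Y Y' u v \<cdot> k) = v \<cdot> uncurry X Y k \<cdot> (Ident M Z \<otimes>\<^sub>a u)"
    if k: "k \<in> Hom M Z ?H"
  proof -
    note [simp] = k Hom_Obj1[OF k]
    let ?k = "\<langle>Z, k, ?H\<rangle>"
    have "(?v \<bullet> ?e \<bullet> (\<one> ?H \<boxtimes> ?u)) \<bullet> (?k \<boxtimes> \<one> X') = ?v \<bullet> (?e \<bullet> (?k \<boxtimes> \<one> X)) \<bullet> (\<one> Z \<boxtimes> ?u)"
      by (simp add: tns_cmp)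
    then show ?thesis using uncurry_natural[OF k t(1)] t(2) by (simp add: typed_arrow_defs uncurry_def)
  qed
qed

text \<open>As for \<open>ihom_map\<close>, with a pair of generalized elements. Their parameter
  objects \<open>Z\<close> and \<open>W\<close> stay separate, so that the composite has parameter
  object \<open>Z \<otimes> W\<close>.\<close>

lemma uncurry_ihom_comp:
  assumes [simp]: "X \<in> Obj M" "Y \<in> Obj M" "V \<in> Obj M"
  shows "ihom_comp M X Y V \<in> Hom M (IHom M Y V \<otimes> IHom M X Y) (IHom M X V)"
    and "\<lbrakk>k \<in> Hom M Z (IHom M Y V); j \<in> Hom M W (IHom M X Y)\<rbrakk> \<Longrightarrow>
      uncurry X V (ihom_comp M X Y V \<cdot> (k \<otimes>\<^sub>a j)) =
      uncurry Y V k \<cdot> (Ident M Z \<otimes>\<^sub>a uncurry X Y j) \<cdot> Assoc M Z W X"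
proof -
  note [simp] = Eval_Hom
  let ?H = "IHom M Y V" and ?G = "IHom M X Y"
  let ?e = "\<langle>?H \<otimes> Y, Eval M Y V, V\<rangle>" and ?f = "\<langle>?G \<otimes> X, Eval M X Y, Y\<rangle>"
  have "arr (?e \<bullet> (\<one> ?H \<boxtimes> ?f) \<bullet> \<a> ?H ?G X)" by simp
  then have "Eval M Y V \<cdot> (Ident M ?H \<otimes>\<^sub>a Eval M X Y) \<cdot> Assoc M ?H ?G X \<in> Hom M ((?H \<otimes> ?G) \<otimes> X) V"
    by (simp add: typed_arrow_defs)
  note t = transpose[OF _ _ _ this, folded ihom_comp_def, simplified]
  show "ihom_comp M X Y V \<in> Hom M (?H \<otimes> ?G) (IHom M X V)" by (rule t)
  show "uncurry X V (ihom_comp M X Y V \<cdot> (k \<otimes>\<^sub>a j)) =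
      uncurry Y V k \<cdot> (Ident M Z \<otimes>\<^sub>a uncurry X Y j) \<cdot> Assoc M Z W X"
    if k: "k \<in> Hom M Z ?H" and j: "j \<in> Hom M W ?G"
  proof -
    note [simp] = k Hom_Obj1[OF k] j Hom_Obj1[OF j]
    let ?k = "\<langle>Z, k, ?H\<rangle>" and ?j = "\<langle>W, j, ?G\<rangle>"
    have "(?e \<bullet> (\<one> ?H \<boxtimes> ?f) \<bullet> \<a> ?H ?G X) \<bullet> ((?k \<boxtimes> ?j) \<boxtimes> \<one> X) =
        (?e \<bullet> (?k \<boxtimes> \<one> Y)) \<bullet> (\<one> Z \<boxtimes> (?f \<bullet> (?j \<boxtimes> \<one> X))) \<bullet> \<a> Z W X"
      by (simp add: assoc_nat tns_cmp tail[OF tns_cmp])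
    then show ?thesis using uncurry_natural[OF TensorArr_Hom[OF k j] t(1)] t(2)
      by (simp add: typed_arrow_defs uncurry_def)
  qed
qed

lemma uncurry_ihom_name:
  assumes "f \<in> Hom M X Y"
  shows "ihom_name M X Y f \<in> Hom M (MUnit M) (IHom M X Y)" "uncurry X Y (ihom_name M X Y f) = f \<cdot> LUnit M X"
  using transpose[OF Hom_Obj1[OF assms] Hom_Obj2[OF assms] MUnit_Obj
    Comp_Hom[OF LUnit_Hom[OF Hom_Obj1[OF assms]] assms]] unfolding ihom_name_def by auto

end

section \<open>Maps into the object of module maps\<close>

locale bicomplete_closed_smc = closed_smc M
  for M :: "('o, 'a) closed_monoidal_data" (structure) +
  assumes finite_limits: "has_finite_limits M" and finite_colimits: "has_finite_colimits M"
begin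

lemma monoidD:
  assumes "is_monoid M E"
  shows "MonObj E \<in> Obj M" "MonMult E \<in> Hom M (MonObj E \<otimes> MonObj E) (MonObj E)"
    "MonUnit E \<in> Hom M (MUnit M) (MonObj E)"
  using assms unfolding is_monoid_def Let_def by blast+

lemma right_moduleD:
  assumes "is_right_module M E X"
  shows "ModObj X \<in> Obj M" "ModAct X \<in> Hom M (ModObj X \<otimes> MonObj E) (ModObj X)"
    "ModAct X \<cdot> (ModAct X \<otimes>\<^sub>a Ident M (MonObj E)) =
      ModAct X \<cdot> (Ident M (ModObj X) \<otimes>\<^sub>a MonMult E) \<cdot> Assoc M (ModObj X) (MonObj E) (MonObj E)"
    "ModAct X \<cdot> (Ident M (ModObj X) \<otimes>\<^sub>a MonUnit E) = RUnit M (ModObj X)"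
  using assms unfolding is_right_module_def Let_def by blast+

text \<open>Module maps from \<open>X\<close> to \<open>Y\<close> with a parameter in
  \<open>Z\<close>; they turn out to be the adjoints of maps
  \<open>Z \<rightarrow> modhom M E X Y\<close>. The same equation expresses the compatibility of
  the two actions of a bimodule and the associativity of a right action.\<close>

definition equivariant ::
  "('o, 'a) monoid_data \<Rightarrow> ('o, 'a) module_data \<Rightarrow> ('o, 'a) module_data \<Rightarrow> 'o \<Rightarrow> 'a \<Rightarrow> bool" where
  "equivariant E X Y Z g \<longleftrightarrow> Z \<in> Obj M \<and> g \<in> Hom M (Z \<otimes> ModObj X) (ModObj Y) \<and>
     g \<cdot> (Ident M Z \<otimes>\<^sub>a ModAct X) \<cdot> Assoc M Z (ModObj X) (MonObj E) =
     ModAct Y \<cdot> (g \<otimes>\<^sub>a Ident M (MonObj E))"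

context
  fixes E :: "('o, 'a) monoid_data"
  assumes E: "is_monoid M E"
begin

lemma hom_act_dom:
  assumes X: "is_right_module M E X" and Y: "is_right_module M E Y"
  shows "hom_act_dom M E X Y \<in> Hom M (IHom M (ModObj X) (ModObj Y)) (IHom M (ModObj X \<otimes> MonObj E) (ModObj Y))"
    and "k \<in> Hom M Z (IHom M (ModObj X) (ModObj Y)) \<Longrightarrow>
      uncurry (ModObj X \<otimes> MonObj E) (ModObj Y) (hom_act_dom M E X Y \<cdot> k) =
      uncurry (ModObj X) (ModObj Y) k \<cdot> (Ident M Z \<otimes>\<^sub>a ModAct X)"
proof -
  note m = right_moduleD(1,2)[OF X] Ident_Hom[OF right_moduleD(1)[OF Y]]
  show "hom_act_dom M E X Y \<in> Hom M (IHom M (ModObj X) (ModObj Y)) (IHom M (ModObj X \<otimes> MonObj E) (ModObj Y))"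
    unfolding hom_act_dom_def by (rule uncurry_ihom_map(1)[OF m(2,3)])
  assume k: "k \<in> Hom M Z (IHom M (ModObj X) (ModObj Y))"
  have "uncurry (ModObj X) (ModObj Y) k \<cdot> (Ident M Z \<otimes>\<^sub>a ModAct X) \<in> Hom M (Z \<otimes> (ModObj X \<otimes> MonObj E)) (ModObj Y)"
    by (rule Comp_Hom[OF TensorArr_Hom[OF Ident_Hom[OF Hom_Obj1[OF k]] m(2)] uncurry_Hom[OF k m(1) right_moduleD(1)[OF Y]]])
  then show "uncurry (ModObj X \<otimes> MonObj E) (ModObj Y) (hom_act_dom M E X Y \<cdot> k) =
      uncurry (ModObj X) (ModObj Y) k \<cdot> (Ident M Z \<otimes>\<^sub>a ModAct X)"
    unfolding hom_act_dom_def by (simp add: uncurry_ihom_map(2)[OF m(2,3) k] Ident_left)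
qed

lemma hom_act_cod:
  assumes X: "is_right_module M E X" and Y: "is_right_module M E Y"
  shows "hom_act_cod M E X Y \<in> Hom M (IHom M (ModObj X) (ModObj Y)) (IHom M (ModObj X \<otimes> MonObj E) (ModObj Y))"
    and "k \<in> Hom M Z (IHom M (ModObj X) (ModObj Y)) \<Longrightarrow>
      uncurry (ModObj X \<otimes> MonObj E) (ModObj Y) (hom_act_cod M E X Y \<cdot> k) =
      ModAct Y \<cdot> (uncurry (ModObj X) (ModObj Y) k \<otimes>\<^sub>a Ident M (MonObj E)) \<cdot> Assoc_inv Z (ModObj X) (MonObj E)"
proof -
  let ?x = "ModObj X" and ?y = "ModObj Y" and ?e = "MonObj E"
  let ?H = "IHom M ?x ?y"
  note [simp] = monoidD[OF E] right_moduleD(1,2)[OF X] right_moduleD(1,2)[OF Y] Eval_Hom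
  let ?r = "\<langle>?y \<otimes> ?e, ModAct Y, ?y\<rangle>" and ?v = "\<langle>?H \<otimes> ?x, Eval M ?x ?y, ?y\<rangle>"
  have "arr (?r \<bullet> (?v \<boxtimes> \<one> ?e) \<bullet> \<b> ?H ?x ?e)" by simp
  then have "ModAct Y \<cdot> (Eval M ?x ?y \<otimes>\<^sub>a Ident M ?e) \<cdot> Assoc_inv ?H ?x ?e \<in> Hom M (?H \<otimes> (?x \<otimes> ?e)) ?y"
    by (simp add: typed_arrow_defs)
  note t = transpose[OF _ _ _ this, folded hom_act_cod_def[unfolded Let_def], simplified]
  show "hom_act_cod M E X Y \<in> Hom M ?H (IHom M (?x \<otimes> ?e) ?y)" by (rule t)
  assume k: "k \<in> Hom M Z ?H"
  note [simp] = k Hom_Obj1[OF k]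
  let ?k = "\<langle>Z, k, ?H\<rangle>"
  have "(?r \<bullet> (?v \<boxtimes> \<one> ?e) \<bullet> \<b> ?H ?x ?e) \<bullet> (?k \<boxtimes> \<one> (?x \<otimes> ?e)) =
      ?r \<bullet> ((?v \<bullet> (?k \<boxtimes> \<one> ?x)) \<boxtimes> \<one> ?e) \<bullet> \<b> Z ?x ?e"
    by (simp add: assoc_inv_nat_left whisker_right)
  then show "uncurry (?x \<otimes> ?e) ?y (hom_act_cod M E X Y \<cdot> k) =
      ModAct Y \<cdot> (uncurry ?x ?y k \<otimes>\<^sub>a Ident M ?e) \<cdot> Assoc_inv Z ?x ?e"
    using uncurry_natural[OF k t(1)] t(2) by (simp add: typed_arrow_defs uncurry_def)
qed

text \<open>Both maps are compared after the injective \<open>uncurry\<close>. The one from the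
  action on \<open>X\<close> becomes precomposition with that action; the one from the action on
  \<open>Y\<close> involves an inverse associator, which is moved to the other side.\<close>

lemma hom_act_eq_iff:
  assumes X: "is_right_module M E X" and Y: "is_right_module M E Y"
    and k: "k \<in> Hom M Z (IHom M (ModObj X) (ModObj Y))"
  shows "hom_act_dom M E X Y \<cdot> k = hom_act_cod M E X Y \<cdot> k \<longleftrightarrow>
    equivariant E X Y Z (uncurry (ModObj X) (ModObj Y) k)"
proof -
  let ?x = "ModObj X" and ?y = "ModObj Y" and ?e = "MonObj E"
  let ?g = "uncurry ?x ?y k"
  note [simp] = monoidD[OF E] right_moduleD(1,2)[OF X] right_moduleD(1,2)[OF Y]
  have g[simp]: "?g \<in> Hom M (Z \<otimes> ?x) ?y" and [simp]: "Z \<in> Obj M"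
    using uncurry_Hom[OF k] Hom_Obj1[OF k] by simp_all
  let ?r = "\<langle>?y \<otimes> ?e, ModAct Y, ?y\<rangle>" and ?s = "\<langle>?x \<otimes> ?e, ModAct X, ?x\<rangle>"
    and ?G = "\<langle>Z \<otimes> ?x, ?g, ?y\<rangle>"
  have "hom_act_dom M E X Y \<cdot> k = hom_act_cod M E X Y \<cdot> k \<longleftrightarrow>
      uncurry (?x \<otimes> ?e) ?y (hom_act_dom M E X Y \<cdot> k) = uncurry (?x \<otimes> ?e) ?y (hom_act_cod M E X Y \<cdot> k)"
    using uncurry_inj[OF _ Comp_Hom[OF k hom_act_dom(1)[OF X Y]] Comp_Hom[OF k hom_act_cod(1)[OF X Y]]]
    by auto
  also have "\<dots> \<longleftrightarrow> ?G \<bullet> (\<one> Z \<boxtimes> ?s) = ?r \<bullet> (?G \<boxtimes> \<one> ?e) \<bullet> \<b> Z ?x ?e"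
    by (simp add: hom_act_dom(2)[OF X Y k] hom_act_cod(2)[OF X Y k]) (simp add: typed_arrow_defs)
  also have "\<dots> \<longleftrightarrow> ?G \<bullet> (\<one> Z \<boxtimes> ?s) \<bullet> \<a> Z ?x ?e = ?r \<bullet> (?G \<boxtimes> \<one> ?e)" (is "?l1 = ?r1 \<longleftrightarrow> ?l2 = ?r2")
  proof
    assume "?l1 = ?r1"
    then have "?l1 \<bullet> \<a> Z ?x ?e = ?r1 \<bullet> \<a> Z ?x ?e" by simp
    then show "?l2 = ?r2" by simp
  next
    assume "?l2 = ?r2"
    then have "?l2 \<bullet> \<b> Z ?x ?e = ?r2 \<bullet> \<b> Z ?x ?e" by simp
    then show "?l1 = ?r1" by simp
  qed
  also have "\<dots> \<longleftrightarrow> equivariant E X Y Z ?g"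
    by (simp add: equivariant_def) (simp add: typed_arrow_defs)
  finally show ?thesis .
qed

end

end

lemma Mod_sel [simp]:
  "Obj (Mod M E) = {X. is_right_module M E X}"
  "Ident (Mod M E) X = Ident M (ModObj X)"
  "Comp (Mod M E) = Comp M"
  by (simp_all add: Mod_def)

lemma Mod_Hom_iff:
  "f \<in> Hom (Mod M E) X Y \<longleftrightarrow> is_right_module M E X \<and> is_right_module M E Y \<and>
     f \<in> Hom M (ModObj X) (ModObj Y) \<and>
     f \<cdot>\<^bsub>M\<^esub> ModAct X = ModAct Y \<cdot>\<^bsub>M\<^esub> (f \<otimes>\<^sub>a\<^bsub>M\<^esub> Ident M (MonObj E))"
  by (simp add: Mod_def)

section \<open>The category of right modules and closure properties of equivariant maps\<close>

context bicomplete_closed_smc begin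

context
  fixes E :: "('o, 'a) monoid_data"
  assumes E: "is_monoid M E"
begin

lemma category_Mod: "category (Mod M E)"
proof (rule category.intro)
  fix f X Y assume "f \<in> Hom (Mod M E) X Y"
  then show "X \<in> Obj (Mod M E) \<and> Y \<in> Obj (Mod M E)" by (simp add: Mod_Hom_iff)
  show "Ident (Mod M E) Y \<cdot>\<^bsub>Mod M E\<^esub> f = f" "f \<cdot>\<^bsub>Mod M E\<^esub> Ident (Mod M E) X = f"
    using \<open>f \<in> Hom (Mod M E) X Y\<close> by (auto simp: Mod_Hom_iff intro: Ident_left Ident_right)
next
  fix X assume "X \<in> Obj (Mod M E)"
  then have X: "is_right_module M E X" by simp
  note m = right_moduleD(1,2)[OF X]
  show "Ident (Mod M E) X \<in> Hom (Mod M E) X X"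
    using X m by (simp add: Mod_Hom_iff Ident_Hom TensorArr_Ident monoidD(1)[OF E] Ident_left Ident_right)
next
  fix f g X Y V assume fg: "f \<in> Hom (Mod M E) X Y" "g \<in> Hom (Mod M E) Y V"
  then have X: "is_right_module M E X" and Y: "is_right_module M E Y" and V: "is_right_module M E V"
    and f: "f \<in> Hom M (ModObj X) (ModObj Y)" and g: "g \<in> Hom M (ModObj Y) (ModObj V)"
    and fa: "f \<cdot> ModAct X = ModAct Y \<cdot> (f \<otimes>\<^sub>a Ident M (MonObj E))"
    and ga: "g \<cdot> ModAct Y = ModAct V \<cdot> (g \<otimes>\<^sub>a Ident M (MonObj E))"
    by (simp_all add: Mod_Hom_iff)
  note [simp] = f g monoidD(1)[OF E] right_moduleD(1,2)[OF X] right_moduleD(1,2)[OF Y] right_moduleD(1,2)[OF V]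
  let ?e = "MonObj E"
  let ?f = "\<langle>ModObj X, f, ModObj Y\<rangle>" and ?g = "\<langle>ModObj Y, g, ModObj V\<rangle>"
    and ?x = "\<langle>ModObj X \<otimes> ?e, ModAct X, ModObj X\<rangle>" and ?y = "\<langle>ModObj Y \<otimes> ?e, ModAct Y, ModObj Y\<rangle>"
    and ?v = "\<langle>ModObj V \<otimes> ?e, ModAct V, ModObj V\<rangle>"
  have fa': "?f \<bullet> ?x = ?y \<bullet> (?f \<boxtimes> \<one> ?e)" and ga': "?g \<bullet> ?y = ?v \<bullet> (?g \<boxtimes> \<one> ?e)"
    using fa ga by (simp_all add: typed_arrow_defs)
  have "(?g \<bullet> ?f) \<bullet> ?x = ?v \<bullet> ((?g \<bullet> ?f) \<boxtimes> \<one> ?e)"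
    by (simp add: fa' tail[OF ga'] whisker_right)
  then have "(g \<cdot> f) \<cdot> ModAct X = ModAct V \<cdot> ((g \<cdot> f) \<otimes>\<^sub>a Ident M ?e)" by (simp add: typed_arrow_defs)
  then show "g \<cdot>\<^bsub>Mod M E\<^esub> f \<in> Hom (Mod M E) X V"
    using X V Comp_Hom[OF f g] by (simp add: Mod_Hom_iff)
next
  fix f g h X Y V W
  assume "f \<in> Hom (Mod M E) X Y" "g \<in> Hom (Mod M E) Y V" "h \<in> Hom (Mod M E) V W"
  then show "(h \<cdot>\<^bsub>Mod M E\<^esub> g) \<cdot>\<^bsub>Mod M E\<^esub> f = h \<cdot>\<^bsub>Mod M E\<^esub> (g \<cdot>\<^bsub>Mod M E\<^esub> f)"
    by (auto simp: Mod_Hom_iff intro!: Comp_assoc)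
qed

lemma equivariantI:
  assumes "arr G" "src G = Z \<otimes> ModObj X" "tgt G = ModObj Y" "Z \<in> Obj M"
    "G \<bullet> (\<one> Z \<boxtimes> \<langle>ModObj X \<otimes> MonObj E, ModAct X, ModObj X\<rangle>) \<bullet> \<a> Z (ModObj X) (MonObj E) =
      \<langle>ModObj Y \<otimes> MonObj E, ModAct Y, ModObj Y\<rangle> \<bullet> (G \<boxtimes> \<one> (MonObj E))"
  shows "equivariant E X Y Z (und G)"
  using assms by (simp add: equivariant_def arr_def typed_arrow_defs)

text \<open>This is what makes \<open>modhom_comp\<close> well defined. The action of
  \<open>E\<close> passes through \<open>g\<close> by \<open>eg'\<close> and through
  \<open>h\<close> by \<open>eh'\<close>, and the pentagon matches the associators that
  remain.\<close>

lemma equivariant_comp: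
  assumes mX: "is_right_module M E X" and mY: "is_right_module M E Y" and mV: "is_right_module M E V"
    and g: "equivariant E Y V Z g" and h: "equivariant E X Y W h"
  shows "equivariant E X V (Z \<otimes> W) (g \<cdot> (Ident M Z \<otimes>\<^sub>a h) \<cdot> Assoc M Z W (ModObj X))"
proof -
  let ?e = "MonObj E" and ?x = "ModObj X" and ?y = "ModObj Y" and ?v = "ModObj V"
  have gH: "g \<in> Hom M (Z \<otimes> ?y) ?v" "Z \<in> Obj M" and hH: "h \<in> Hom M (W \<otimes> ?x) ?y" "W \<in> Obj M"
    and eg: "g \<cdot> (Ident M Z \<otimes>\<^sub>a ModAct Y) \<cdot> Assoc M Z ?y ?e = ModAct V \<cdot> (g \<otimes>\<^sub>a Ident M ?e)"
    and eh: "h \<cdot> (Ident M W \<otimes>\<^sub>a ModAct X) \<cdot> Assoc M W ?x ?e = ModAct Y \<cdot> (h \<otimes>\<^sub>a Ident M ?e)"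
    using g h unfolding equivariant_def by blast+
  note [simp] = gH hH monoidD(1)[OF E] right_moduleD(1,2)[OF mX] right_moduleD(1,2)[OF mY] right_moduleD(1,2)[OF mV]
  let ?g = "\<langle>Z \<otimes> ?y, g, ?v\<rangle>" and ?h = "\<langle>W \<otimes> ?x, h, ?y\<rangle>" and ?rx = "\<langle>?x \<otimes> ?e, ModAct X, ?x\<rangle>"
    and ?ry = "\<langle>?y \<otimes> ?e, ModAct Y, ?y\<rangle>" and ?rv = "\<langle>?v \<otimes> ?e, ModAct V, ?v\<rangle>"
  have eg': "?rv \<bullet> (?g \<boxtimes> \<one> ?e) = ?g \<bullet> (\<one> Z \<boxtimes> ?ry) \<bullet> \<a> Z ?y ?e"
    using eg by (simp add: typed_arrow_defs)
  have eh': "(\<one> Z \<boxtimes> ?ry) \<bullet> (\<one> Z \<boxtimes> (?h \<boxtimes> \<one> ?e)) = \<one> Z \<boxtimes> (?h \<bullet> (\<one> W \<boxtimes> ?rx) \<bullet> \<a> W ?x ?e)"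
    using eh by (simp add: tns_cmp) (simp add: typed_arrow_defs)
  let ?G = "?g \<bullet> (\<one> Z \<boxtimes> ?h) \<bullet> \<a> Z W ?x"
  have "?G \<bullet> (\<one> (Z \<otimes> W) \<boxtimes> ?rx) \<bullet> \<a> (Z \<otimes> W) ?x ?e = ?rv \<bullet> (?G \<boxtimes> \<one> ?e)"
    by (simp add: whisker_left whisker_right eg' tail[OF eg'] tail[OF eh'] assoc_pentagon
        tail[OF assoc_nat_right] tail[OF assoc_nat])
  then have "equivariant E X V (Z \<otimes> W) (und ?G)" by (rule equivariantI[rotated 4]) simp_all
  then show ?thesis by (simp add: typed_arrow_defs)
qed

text \<open>This is what makes \<open>modhom_map\<close> well defined: the action passes through
  \<open>v\<close>, \<open>g\<close> and \<open>u\<close> in turn.\<close>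

lemma equivariant_conj:
  assumes u: "u \<in> Hom (Mod M E) X' X" and v: "v \<in> Hom (Mod M E) Y Y'" and g: "equivariant E X Y Z g"
  shows "equivariant E X' Y' Z (v \<cdot> g \<cdot> (Ident M Z \<otimes>\<^sub>a u))"
proof -
  have mX: "is_right_module M E X" and mY: "is_right_module M E Y"
    and mX': "is_right_module M E X'" and mY': "is_right_module M E Y'"
    and uH: "u \<in> Hom M (ModObj X') (ModObj X)" and vH: "v \<in> Hom M (ModObj Y) (ModObj Y')"
    and ua: "u \<cdot> ModAct X' = ModAct X \<cdot> (u \<otimes>\<^sub>a Ident M (MonObj E))"
    and va: "v \<cdot> ModAct Y = ModAct Y' \<cdot> (v \<otimes>\<^sub>a Ident M (MonObj E))"
    using u v by (simp_all add: Mod_Hom_iff)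
  let ?e = "MonObj E" and ?x = "ModObj X" and ?y = "ModObj Y" and ?x' = "ModObj X'" and ?y' = "ModObj Y'"
  have gH: "g \<in> Hom M (Z \<otimes> ?x) ?y" "Z \<in> Obj M"
    and eg: "g \<cdot> (Ident M Z \<otimes>\<^sub>a ModAct X) \<cdot> Assoc M Z ?x ?e = ModAct Y \<cdot> (g \<otimes>\<^sub>a Ident M ?e)"
    using g unfolding equivariant_def by blast+
  note [simp] = gH uH vH monoidD(1)[OF E] right_moduleD(1,2)[OF mX] right_moduleD(1,2)[OF mY]
    right_moduleD(1,2)[OF mX'] right_moduleD(1,2)[OF mY']
  let ?g = "\<langle>Z \<otimes> ?x, g, ?y\<rangle>" and ?u = "\<langle>?x', u, ?x\<rangle>" and ?v = "\<langle>?y, v, ?y'\<rangle>"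
    and ?rx = "\<langle>?x \<otimes> ?e, ModAct X, ?x\<rangle>" and ?ry = "\<langle>?y \<otimes> ?e, ModAct Y, ?y\<rangle>"
    and ?rx' = "\<langle>?x' \<otimes> ?e, ModAct X', ?x'\<rangle>" and ?ry' = "\<langle>?y' \<otimes> ?e, ModAct Y', ?y'\<rangle>"
  have eg': "?ry \<bullet> (?g \<boxtimes> \<one> ?e) = ?g \<bullet> (\<one> Z \<boxtimes> ?rx) \<bullet> \<a> Z ?x ?e"
    and va': "?ry' \<bullet> (?v \<boxtimes> \<one> ?e) = ?v \<bullet> ?ry"
    using eg va by (simp_all add: typed_arrow_defs)
  have ua': "(\<one> Z \<boxtimes> ?rx) \<bullet> (\<one> Z \<boxtimes> (?u \<boxtimes> \<one> ?e)) = (\<one> Z \<boxtimes> ?u) \<bullet> (\<one> Z \<boxtimes> ?rx')"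
    using ua by (simp add: tns_cmp) (simp add: typed_arrow_defs)
  let ?G = "?v \<bullet> ?g \<bullet> (\<one> Z \<boxtimes> ?u)"
  have "?G \<bullet> (\<one> Z \<boxtimes> ?rx') \<bullet> \<a> Z ?x' ?e = ?ry' \<bullet> (?G \<boxtimes> \<one> ?e)"
    by (simp add: whisker_right tail[OF va'] tail[OF eg'] tail[OF ua'] assoc_nat)
  then have "equivariant E X' Y' Z (und ?G)" by (rule equivariantI[rotated 4]) simp_all
  then show ?thesis by (simp add: typed_arrow_defs)
qed

text \<open>A module map is a family with parameter in the unit object; the coherence needed is
  \<open>lunit_tns\<close>. This is what makes \<open>modhom_name\<close> well defined.\<close>

lemma equivariant_lunit:
  assumes f: "f \<in> Hom (Mod M E) X Y"
  shows "equivariant E X Y (MUnit M) (f \<cdot> LUnit M (ModObj X))"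
proof -
  have mX: "is_right_module M E X" and mY: "is_right_module M E Y"
    and fH: "f \<in> Hom M (ModObj X) (ModObj Y)"
    and fa: "f \<cdot> ModAct X = ModAct Y \<cdot> (f \<otimes>\<^sub>a Ident M (MonObj E))"
    using f by (simp_all add: Mod_Hom_iff)
  let ?e = "MonObj E" and ?x = "ModObj X" and ?y = "ModObj Y"
  note [simp] = fH monoidD(1)[OF E] right_moduleD(1,2)[OF mX] right_moduleD(1,2)[OF mY]
  let ?f = "\<langle>?x, f, ?y\<rangle>" and ?rx = "\<langle>?x \<otimes> ?e, ModAct X, ?x\<rangle>" and ?ry = "\<langle>?y \<otimes> ?e, ModAct Y, ?y\<rangle>"
  have fa': "?ry \<bullet> (?f \<boxtimes> \<one> ?e) = ?f \<bullet> ?rx" using fa by (simp add: typed_arrow_defs)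
  let ?G = "?f \<bullet> \<l> ?x"
  have "?G \<bullet> (\<one> (MUnit M) \<boxtimes> ?rx) \<bullet> \<a> (MUnit M) ?x ?e = ?ry \<bullet> (?G \<boxtimes> \<one> ?e)"
    by (simp add: whisker_right tail[OF fa'] tail[OF lunit_nat] lunit_tns)
  then have "equivariant E X Y (MUnit M) (und ?G)" by (rule equivariantI[rotated 4]) simp_all
  then show ?thesis by (simp add: typed_arrow_defs)
qed

section \<open>The adjunction between tensoring with a module and the object of module maps\<close>

lemma modhom_equalizer:
  assumes "is_right_module M E X" "is_right_module M E Y"
  shows "is_equalizer M (IHom M (ModObj X) (ModObj Y)) (IHom M (ModObj X \<otimes> MonObj E) (ModObj Y))
    (hom_act_dom M E X Y) (hom_act_cod M E X Y) (modhom M E X Y) (modhom_incl M E X Y)"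
  unfolding modhom_def modhom_incl_def modhom_equalizer_def
  by (rule is_equalizer_equalizer[OF finite_limits hom_act_dom(1)[OF E assms] hom_act_cod(1)[OF E assms]])

lemma modhom_incl_Hom:
  assumes "is_right_module M E X" "is_right_module M E Y"
  shows "modhom_incl M E X Y \<in> Hom M (modhom M E X Y) (IHom M (ModObj X) (ModObj Y))"
  using modhom_equalizer[OF assms] by (simp add: is_equalizer_def)

text \<open>By \<open>hom_act_eq_iff\<close>, equivariance is exactly the equalizing condition on
  \<open>k\<close>. Since the factorization is unique, this also shows that the descriptions
  defining \<open>modhom_comp\<close>, \<open>modhom_map\<close> and \<open>modhom_name\<close>
  denote.\<close>

lemma modhom_factor:
  assumes X: "is_right_module M E X" and Y: "is_right_module M E Y"
    and k: "k \<in> Hom M Z (IHom M (ModObj X) (ModObj Y))"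
    and "equivariant E X Y Z (uncurry (ModObj X) (ModObj Y) k)"
  shows "\<exists>!c. c \<in> Hom M Z (modhom M E X Y) \<and> modhom_incl M E X Y \<cdot> c = k"
  using modhom_equalizer[OF X Y] k hom_act_eq_iff[OF E X Y k] assms(4) unfolding is_equalizer_def by blast

text \<open>The counterpart of \<open>uncurry\<close> for \<open>modhom\<close>. It is a bijection
  onto the equivariant maps, by \<open>equivariant_mod_uncurry\<close>,
  \<open>mod_uncurry_inj\<close> and \<open>mod_uncurry_surj\<close>.\<close>

definition mod_uncurry :: "('o, 'a) module_data \<Rightarrow> ('o, 'a) module_data \<Rightarrow> 'a \<Rightarrow> 'a" where
  "mod_uncurry X Y k = uncurry (ModObj X) (ModObj Y) (modhom_incl M E X Y \<cdot> k)"

text \<open>The inclusion equalizes the two maps, hence so does its composite with \<open>k\<close>;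
  now \<open>hom_act_eq_iff\<close> applies.\<close>

lemma equivariant_mod_uncurry:
  assumes X: "is_right_module M E X" and Y: "is_right_module M E Y"
    and k: "k \<in> Hom M Z (modhom M E X Y)"
  shows "equivariant E X Y Z (mod_uncurry X Y k)"
proof -
  note i = modhom_incl_Hom[OF X Y]
  have "hom_act_dom M E X Y \<cdot> modhom_incl M E X Y = hom_act_cod M E X Y \<cdot> modhom_incl M E X Y"
    using modhom_equalizer[OF X Y] by (simp add: is_equalizer_def)
  then show ?thesis unfolding mod_uncurry_def
    by (simp add: hom_act_eq_iff[OF E X Y Comp_Hom[OF k i], symmetric]
        Comp_assoc[OF k i hom_act_dom(1)[OF E X Y], symmetric]
        Comp_assoc[OF k i hom_act_cod(1)[OF E X Y], symmetric])
qed

text \<open>The adjunction is injective and the inclusion of an equalizer is mono.\<close>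

lemma mod_uncurry_inj:
  assumes X: "is_right_module M E X" and Y: "is_right_module M E Y"
    and k: "k \<in> Hom M Z (modhom M E X Y)" "k' \<in> Hom M Z (modhom M E X Y)"
    and "mod_uncurry X Y k = mod_uncurry X Y k'"
  shows "k = k'"
proof -
  note i = modhom_incl_Hom[OF X Y]
  have "modhom_incl M E X Y \<cdot> k = modhom_incl M E X Y \<cdot> k'"
    by (rule uncurry_inj[OF assms(5)[unfolded mod_uncurry_def] Comp_Hom[OF k(1) i] Comp_Hom[OF k(2) i]
        right_moduleD(1)[OF X] right_moduleD(1)[OF Y]])
  then show ?thesis by (rule equalizer_cancel[OF modhom_equalizer[OF X Y] k])
qed

text \<open>The transpose of an equivariant map factors through the equalizer.\<close>

lemma mod_uncurry_surj:
  assumes X: "is_right_module M E X" and Y: "is_right_module M E Y" and g: "equivariant E X Y Z g"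
  obtains k where "k \<in> Hom M Z (modhom M E X Y)" "mod_uncurry X Y k = g"
proof -
  have "Z \<in> Obj M" "g \<in> Hom M (Z \<otimes> ModObj X) (ModObj Y)"
    using g by (simp_all add: equivariant_def)
  note t = transpose[OF right_moduleD(1)[OF X] right_moduleD(1)[OF Y] this]
  have "equivariant E X Y Z (uncurry (ModObj X) (ModObj Y) (transpose M (ModObj X) (ModObj Y) Z g))"
    using g t(2) by simp
  from modhom_factor[OF X Y t(1) this] obtain k where "k \<in> Hom M Z (modhom M E X Y)"
    "modhom_incl M E X Y \<cdot> k = transpose M (ModObj X) (ModObj Y) Z g" by blast
  then show ?thesis using that[of k] t(2) by (simp add: mod_uncurry_def)
qed

lemma mod_uncurry_natural:
  assumes X: "is_right_module M E X" and Y: "is_right_module M E Y"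
    and k: "k \<in> Hom M Z (modhom M E X Y)" and j: "j \<in> Hom M Z' Z"
  shows "mod_uncurry X Y (k \<cdot> j) = mod_uncurry X Y k \<cdot> (j \<otimes>\<^sub>a Ident M (ModObj X))"
  unfolding mod_uncurry_def
  using uncurry_natural[OF j Comp_Hom[OF k modhom_incl_Hom[OF X Y]] right_moduleD(1)[OF X] right_moduleD(1)[OF Y]]
  by (simp add: Comp_assoc[OF j k modhom_incl_Hom[OF X Y]])

text \<open>Composition of module maps on generalized elements. The composite of the two inclusions
  is equivariant, so it factors through the equalizer, and \<open>modhom_comp\<close> is this
  factorization; the formula is then inherited from \<open>ihom_comp\<close>.\<close>

lemma mod_uncurry_comp:
  assumes X: "is_right_module M E X" and Y: "is_right_module M E Y" and V: "is_right_module M E V"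
  shows "modhom_comp M E X Y V \<in> Hom M (modhom M E Y V \<otimes> modhom M E X Y) (modhom M E X V)"
    and "\<lbrakk>k \<in> Hom M Z (modhom M E Y V); j \<in> Hom M W (modhom M E X Y)\<rbrakk> \<Longrightarrow>
      mod_uncurry X V (modhom_comp M E X Y V \<cdot> (k \<otimes>\<^sub>a j)) =
      mod_uncurry Y V k \<cdot> (Ident M Z \<otimes>\<^sub>a mod_uncurry X Y j) \<cdot> Assoc M Z W (ModObj X)"
proof -
  let ?P = "modhom M E Y V" and ?Q = "modhom M E X Y"
  note O = right_moduleD(1)[OF X] right_moduleD(1)[OF Y] right_moduleD(1)[OF V]
  note i = modhom_incl_Hom[OF Y V] and i' = modhom_incl_Hom[OF X Y] and i'' = modhom_incl_Hom[OF X V]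
  note ii = TensorArr_Hom[OF i i']
  let ?c = "ihom_comp M (ModObj X) (ModObj Y) (ModObj V)"
  note c = uncurry_ihom_comp[OF O]
  \<comment> \<open>The uncurried inclusion is \<open>mod_uncurry\<close> of an identity, so it is
    equivariant with the hom object itself as parameter.\<close>
  have "equivariant E Y V ?P (uncurry (ModObj Y) (ModObj V) (modhom_incl M E Y V))"
    "equivariant E X Y ?Q (uncurry (ModObj X) (ModObj Y) (modhom_incl M E X Y))"
    using equivariant_mod_uncurry[OF Y V Ident_Hom[OF Hom_Obj1[OF i]]]
      equivariant_mod_uncurry[OF X Y Ident_Hom[OF Hom_Obj1[OF i']]]
    by (simp_all add: mod_uncurry_def Ident_right[OF i] Ident_right[OF i'])
  from equivariant_comp[OF X Y V this]
  have "equivariant E X V (?P \<otimes> ?Q)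
      (uncurry (ModObj X) (ModObj V) (?c \<cdot> (modhom_incl M E Y V \<otimes>\<^sub>a modhom_incl M E X Y)))"
    by (simp add: c(2)[OF i i'])
  note f = theI'[OF modhom_factor[OF X V Comp_Hom[OF ii c(1)] this], folded modhom_comp_def]
  then have cH: "modhom_comp M E X Y V \<in> Hom M (?P \<otimes> ?Q) (modhom M E X V)"
    and ic: "modhom_incl M E X V \<cdot> modhom_comp M E X Y V = ?c \<cdot> (modhom_incl M E Y V \<otimes>\<^sub>a modhom_incl M E X Y)"
    by auto
  show "modhom_comp M E X Y V \<in> Hom M (?P \<otimes> ?Q) (modhom M E X V)" by (rule cH)
  assume k: "k \<in> Hom M Z ?P" and j: "j \<in> Hom M W ?Q"
  note kj = TensorArr_Hom[OF k j]
  have "modhom_incl M E X V \<cdot> (modhom_comp M E X Y V \<cdot> (k \<otimes>\<^sub>a j)) =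
      ?c \<cdot> ((modhom_incl M E Y V \<otimes>\<^sub>a modhom_incl M E X Y) \<cdot> (k \<otimes>\<^sub>a j))"
    by (simp add: Comp_assoc[OF kj cH i'', symmetric] Comp_assoc[OF kj ii c(1), symmetric] ic)
  also have "\<dots> = ?c \<cdot> ((modhom_incl M E Y V \<cdot> k) \<otimes>\<^sub>a (modhom_incl M E X Y \<cdot> j))"
    by (simp add: TensorArr_Comp[OF k i j i'])
  finally show "mod_uncurry X V (modhom_comp M E X Y V \<cdot> (k \<otimes>\<^sub>a j)) =
      mod_uncurry Y V k \<cdot> (Ident M Z \<otimes>\<^sub>a mod_uncurry X Y j) \<cdot> Assoc M Z W (ModObj X)"
    by (simp add: mod_uncurry_def c(2)[OF Comp_Hom[OF k i] Comp_Hom[OF j i']])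
qed

text \<open>The same argument as for composition, with \<open>equivariant_conj\<close> supplying the
  factorization.\<close>

lemma mod_uncurry_map:
  assumes u: "u \<in> Hom (Mod M E) X' X" and v: "v \<in> Hom (Mod M E) Y Y'"
  shows "modhom_map M E X' X Y Y' u v \<in> Hom M (modhom M E X Y) (modhom M E X' Y')"
    and "k \<in> Hom M Z (modhom M E X Y) \<Longrightarrow>
      mod_uncurry X' Y' (modhom_map M E X' X Y Y' u v \<cdot> k) = v \<cdot> mod_uncurry X Y k \<cdot> (Ident M Z \<otimes>\<^sub>a u)"
proof -
  have X: "is_right_module M E X" and Y: "is_right_module M E Y"
    and X': "is_right_module M E X'" and Y': "is_right_module M E Y'"
    and uH: "u \<in> Hom M (ModObj X') (ModObj X)" and vH: "v \<in> Hom M (ModObj Y) (ModObj Y')"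
    using u v by (simp_all add: Mod_Hom_iff)
  let ?P = "modhom M E X Y"
  note i = modhom_incl_Hom[OF X Y] and i' = modhom_incl_Hom[OF X' Y']
  let ?c = "ihom_map M (ModObj X') (ModObj X) (ModObj Y) (ModObj Y') u v"
  note c = uncurry_ihom_map[OF uH vH]
  have "equivariant E X Y ?P (uncurry (ModObj X) (ModObj Y) (modhom_incl M E X Y))"
    using equivariant_mod_uncurry[OF X Y Ident_Hom[OF Hom_Obj1[OF i]]]
    by (simp add: mod_uncurry_def Ident_right[OF i])
  from equivariant_conj[OF u v this]
  have "equivariant E X' Y' ?P (uncurry (ModObj X') (ModObj Y') (?c \<cdot> modhom_incl M E X Y))"
    by (simp add: c(2)[OF i])
  note f = theI'[OF modhom_factor[OF X' Y' Comp_Hom[OF i c(1)] this], folded modhom_map_def]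
  then have cH: "modhom_map M E X' X Y Y' u v \<in> Hom M ?P (modhom M E X' Y')"
    and ic: "modhom_incl M E X' Y' \<cdot> modhom_map M E X' X Y Y' u v = ?c \<cdot> modhom_incl M E X Y"
    by auto
  show "modhom_map M E X' X Y Y' u v \<in> Hom M ?P (modhom M E X' Y')" by (rule cH)
  assume k: "k \<in> Hom M Z ?P"
  have "modhom_incl M E X' Y' \<cdot> (modhom_map M E X' X Y Y' u v \<cdot> k) = ?c \<cdot> (modhom_incl M E X Y \<cdot> k)"
    by (simp add: Comp_assoc[OF k cH i', symmetric] Comp_assoc[OF k i c(1), symmetric] ic)
  then show "mod_uncurry X' Y' (modhom_map M E X' X Y Y' u v \<cdot> k) = v \<cdot> mod_uncurry X Y k \<cdot> (Ident M Z \<otimes>\<^sub>a u)"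
    by (simp add: mod_uncurry_def c(2)[OF Comp_Hom[OF k i]])
qed

text \<open>The name of the underlying arrow factors through the equalizer by
  \<open>equivariant_lunit\<close>.\<close>

lemma mod_uncurry_name:
  assumes f: "f \<in> Hom (Mod M E) X Y"
  shows "modhom_name M E X Y f \<in> Hom M (MUnit M) (modhom M E X Y)"
    and "mod_uncurry X Y (modhom_name M E X Y f) = f \<cdot> LUnit M (ModObj X)"
proof -
  have X: "is_right_module M E X" and Y: "is_right_module M E Y"
    and fH: "f \<in> Hom M (ModObj X) (ModObj Y)"
    using f by (simp_all add: Mod_Hom_iff)
  note n = uncurry_ihom_name[OF fH]
  have "equivariant E X Y (MUnit M) (uncurry (ModObj X) (ModObj Y) (ihom_name M (ModObj X) (ModObj Y) f))"
    using equivariant_lunit[OF f] by (simp add: n(2))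
  note f = theI'[OF modhom_factor[OF X Y n(1) this], folded modhom_name_def]
  then show "modhom_name M E X Y f \<in> Hom M (MUnit M) (modhom M E X Y)"
    "mod_uncurry X Y (modhom_name M E X Y f) = f \<cdot> LUnit M (ModObj X)"
    using n(2) by (auto simp: mod_uncurry_def)
qed

lemma mod_uncurry_id:
  assumes X: "is_right_module M E X"
  shows "modhom_id M E X \<in> Hom M (MUnit M) (modhom M E X X)"
    and "mod_uncurry X X (modhom_id M E X) = LUnit M (ModObj X)"
proof -
  have "Ident M (ModObj X) \<in> Hom (Mod M E) X X"
    using category.Ident_Hom[OF category_Mod, of X] X by simp
  note n = mod_uncurry_name[OF this, folded modhom_id_def]
  show "modhom_id M E X \<in> Hom M (MUnit M) (modhom M E X X)" by (rule n)
  show "mod_uncurry X X (modhom_id M E X) = LUnit M (ModObj X)"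
    using n(2) Ident_left[OF LUnit_Hom[OF right_moduleD(1)[OF X]]] by simp
qed

end

end

section \<open>The tensor product over a monoid\<close>

context closed_smc begin

text \<open>Reassociating turns tensoring with \<open>D\<close> and then \<open>D'\<close> into
  tensoring once with \<open>D \<otimes> D'\<close>. This is needed for the associativity law of an
  induced action, where two copies of the monoid occur.\<close>

lemma tensor_coequalizer_cancel2:
  assumes q: "is_coequalizer M A B f g Q q" and D: "D \<in> Obj M" and D': "D' \<in> Obj M"
    and u: "u \<in> Hom M ((Q \<otimes> D) \<otimes> D') Z" and v: "v \<in> Hom M ((Q \<otimes> D) \<otimes> D') Z"
    and eq: "u \<cdot> ((q \<otimes>\<^sub>a Ident M D) \<otimes>\<^sub>a Ident M D') = v \<cdot> ((q \<otimes>\<^sub>a Ident M D) \<otimes>\<^sub>a Ident M D')"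
  shows "u = v"
proof -
  have qH: "q \<in> Hom M B Q" using q unfolding is_coequalizer_def by blast
  note [simp] = D D' u v qH Hom_Obj1[OF qH] Hom_Obj2[OF qH]
  let ?q = "\<langle>B, q, Q\<rangle>" and ?u = "\<langle>(Q \<otimes> D) \<otimes> D', u, Z\<rangle>" and ?v = "\<langle>(Q \<otimes> D) \<otimes> D', v, Z\<rangle>"
  have eq': "?u \<bullet> ((?q \<boxtimes> \<one> D) \<boxtimes> \<one> D') = ?v \<bullet> ((?q \<boxtimes> \<one> D) \<boxtimes> \<one> D')"
    using eq by (simp add: typed_arrow_defs)
  have "(?u \<bullet> \<b> Q D D') \<bullet> (?q \<boxtimes> \<one> (D \<otimes> D')) = (?v \<bullet> \<b> Q D D') \<bullet> (?q \<boxtimes> \<one> (D \<otimes> D'))"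
    by (simp add: assoc_inv_nat_left tail[OF eq'])
  then have eq'': "(u \<cdot> Assoc_inv Q D D') \<cdot> (q \<otimes>\<^sub>a Ident M (D \<otimes> D')) = (v \<cdot> Assoc_inv Q D D') \<cdot> (q \<otimes>\<^sub>a Ident M (D \<otimes> D'))"
    by (simp add: typed_arrow_defs)
  have b: "Assoc_inv Q D D' \<in> Hom M (Q \<otimes> (D \<otimes> D')) ((Q \<otimes> D) \<otimes> D')"
    by (rule Assoc_inv) simp_all
  have "u \<cdot> Assoc_inv Q D D' = v \<cdot> Assoc_inv Q D D'"
    by (rule tensor_coequalizer_cancel[OF q Tensor_Obj[OF D D'] Comp_Hom[OF b u] Comp_Hom[OF b v] eq''])
  then have "?u \<bullet> \<b> Q D D' = ?v \<bullet> \<b> Q D D'" by (simp add: typed_arrow_defs)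
  then have "?u = ?v" by (rule section_cancel[OF _ assoc_inv_cmp(2)]) simp_all
  then show ?thesis by simp
qed

end

context bicomplete_closed_smc begin

lemma left_moduleD:
  assumes "is_left_module M E Y"
  shows "ModObj Y \<in> Obj M" "ModAct Y \<in> Hom M (MonObj E \<otimes> ModObj Y) (ModObj Y)"
  using assms unfolding is_left_module_def Let_def by blast+

section \<open>The functor given by tensoring with a bimodule over a monoid\<close>

context
  fixes E E' :: "('o, 'a) monoid_data" and Y :: "('o, 'a) module_data" and l :: 'a
  assumes E: "is_monoid M E" and E': "is_monoid M E'" and bimodule: "is_bimodule M E E' Y l"
begin

abbreviation "Yl \<equiv> \<lparr>ModObj = ModObj Y, ModAct = l\<rparr>"
abbreviation "Q X \<equiv> tensor_over M E X Yl"
abbreviation "q X \<equiv> tensor_over_proj M E X Yl"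
abbreviation "QM X \<equiv> tensor_over_module M E E' Y l X"

lemma bimodule_right_module: "is_right_module M E' Y"
  using bimodule by (simp add: is_bimodule_def)

lemma bimodule_left_act_Hom: "l \<in> Hom M (MonObj E \<otimes> ModObj Y) (ModObj Y)"
  using bimodule left_moduleD[of E Yl] by (simp add: is_bimodule_def)

lemmas bimodule_types = monoidD(1)[OF E] bimodule_left_act_Hom monoidD[OF E'] right_moduleD(1,2)[OF bimodule_right_module]

lemma tensor_over_is_coequalizer:
  assumes X: "is_right_module M E X"
  shows "is_coequalizer M ((ModObj X \<otimes> MonObj E) \<otimes> ModObj Y) (ModObj X \<otimes> ModObj Y)
    (ModAct X \<otimes>\<^sub>a Ident M (ModObj Y)) ((Ident M (ModObj X) \<otimes>\<^sub>a l) \<cdot> Assoc M (ModObj X) (MonObj E) (ModObj Y))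
    (Q X) (q X)"
proof -
  note [simp] = bimodule_types right_moduleD(1,2)[OF X]
  have "arr ((\<one> (ModObj X) \<boxtimes> \<langle>MonObj E \<otimes> ModObj Y, l, ModObj Y\<rangle>) \<bullet> \<a> (ModObj X) (MonObj E) (ModObj Y))"
    by simp
  then have "(Ident M (ModObj X) \<otimes>\<^sub>a l) \<cdot> Assoc M (ModObj X) (MonObj E) (ModObj Y) \<in>
      Hom M ((ModObj X \<otimes> MonObj E) \<otimes> ModObj Y) (ModObj X \<otimes> ModObj Y)"
    by (simp add: typed_arrow_defs)
  from is_coequalizer_coequalizer[OF finite_colimits TensorArr_Hom[OF right_moduleD(2)[OF X] Ident_Hom[OF right_moduleD(1)[OF bimodule_right_module]]] this]
  show ?thesis
    by (simp add: tensor_over_def tensor_over_proj_def tensor_over_coequalizer_def Let_def)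
qed

lemma tensor_over_proj:
  assumes X: "is_right_module M E X"
  shows "q X \<in> Hom M (ModObj X \<otimes> ModObj Y) (Q X)"
    "q X \<cdot> (ModAct X \<otimes>\<^sub>a Ident M (ModObj Y)) =
     q X \<cdot> (Ident M (ModObj X) \<otimes>\<^sub>a l) \<cdot> Assoc M (ModObj X) (MonObj E) (ModObj Y)"
  using tensor_over_is_coequalizer[OF X] unfolding is_coequalizer_def by blast+

lemma tensor_over_Obj: "is_right_module M E X \<Longrightarrow> Q X \<in> Obj M"
  by (rule Hom_Obj2[OF tensor_over_proj(1)])

text \<open>Acting on \<open>Y\<close> and then projecting coequalizes the defining pair tensored
  with \<open>E'\<close>, because the left and right actions on \<open>Y\<close> are compatible
  (\<open>lr\<close>). Since tensoring preserves coequalizers, it descends to an action on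
  \<open>Q X\<close>.\<close>

lemma tensor_over_module_act:
  assumes X: "is_right_module M E X"
  shows "ModAct (QM X) \<in> Hom M (Q X \<otimes> MonObj E') (Q X)"
    "ModAct (QM X) \<cdot> (q X \<otimes>\<^sub>a Ident M (MonObj E')) =
      q X \<cdot> (Ident M (ModObj X) \<otimes>\<^sub>a ModAct Y) \<cdot> Assoc M (ModObj X) (ModObj Y) (MonObj E')"
proof -
  note [simp] = bimodule_types right_moduleD(1,2)[OF X] tensor_over_proj(1)[OF X] tensor_over_Obj[OF X]
  let ?e = "MonObj E" and ?e' = "MonObj E'" and ?x = "ModObj X" and ?y = "ModObj Y"
  let ?q = "\<langle>?x \<otimes> ?y, q X, Q X\<rangle>" and ?rY = "\<langle>?y \<otimes> ?e', ModAct Y, ?y\<rangle>"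
    and ?rX = "\<langle>?x \<otimes> ?e, ModAct X, ?x\<rangle>" and ?l = "\<langle>?e \<otimes> ?y, l, ?y\<rangle>"
  have ql: "?q \<bullet> (?rX \<boxtimes> \<one> ?y) = ?q \<bullet> (\<one> ?x \<boxtimes> ?l) \<bullet> \<a> ?x ?e ?y"
    using tensor_over_proj(2)[OF X] by (simp add: typed_arrow_defs)
  have lr: "(\<one> ?x \<boxtimes> ?rY) \<bullet> (\<one> ?x \<boxtimes> (?l \<boxtimes> \<one> ?e')) = \<one> ?x \<boxtimes> (?l \<bullet> (\<one> ?e \<boxtimes> ?rY) \<bullet> \<a> ?e ?y ?e')"
    using bimodule by (simp add: tns_cmp is_bimodule_def) (simp add: typed_arrow_defs)
  let ?h = "?q \<bullet> (\<one> ?x \<boxtimes> ?rY) \<bullet> \<a> ?x ?y ?e'"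
  \<comment> \<open>The actions on \<open>X\<close> and on \<open>Y\<close> concern different tensor
    factors, so they commute.\<close>
  have ix: "(\<one> ?x \<boxtimes> ?rY) \<bullet> (?rX \<boxtimes> \<one> (?y \<otimes> ?e')) = (?rX \<boxtimes> \<one> ?y) \<bullet> (\<one> (?x \<otimes> ?e) \<boxtimes> ?rY)"
    by (rule interchange[symmetric]) simp_all
  have "?h \<bullet> ((?rX \<boxtimes> \<one> ?y) \<boxtimes> \<one> ?e') = ?q \<bullet> (\<one> ?x \<boxtimes> ?l) \<bullet> (\<one> ?x \<boxtimes> (\<one> ?e \<boxtimes> ?rY)) \<bullet> \<a> ?x ?e (?y \<otimes> ?e') \<bullet> \<a> (?x \<otimes> ?e) ?y ?e'"
    by (simp add: assoc_nat_left tail[OF ix] tail[OF ql] tail[OF assoc_nat_right])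
  also have "\<dots> = ?h \<bullet> (((\<one> ?x \<boxtimes> ?l) \<bullet> \<a> ?x ?e ?y) \<boxtimes> \<one> ?e')"
    by (simp add: whisker_left whisker_right tail[OF assoc_nat] tail[OF lr] assoc_pentagon)
  finally have eq: "(q X \<cdot> (Ident M ?x \<otimes>\<^sub>a ModAct Y) \<cdot> Assoc M ?x ?y ?e') \<cdot> ((ModAct X \<otimes>\<^sub>a Ident M ?y) \<otimes>\<^sub>a Ident M ?e') =
    (q X \<cdot> (Ident M ?x \<otimes>\<^sub>a ModAct Y) \<cdot> Assoc M ?x ?y ?e') \<cdot> (((Ident M ?x \<otimes>\<^sub>a l) \<cdot> Assoc M ?x ?e ?y) \<otimes>\<^sub>a Ident M ?e')"
    by (simp add: typed_arrow_defs)
  have "arr ?h" by simp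
  then have "q X \<cdot> (Ident M ?x \<otimes>\<^sub>a ModAct Y) \<cdot> Assoc M ?x ?y ?e' \<in> Hom M ((?x \<otimes> ?y) \<otimes> ?e') (Q X)"
    by (simp add: typed_arrow_defs)
  from tensor_coequalizer_factor[OF tensor_over_is_coequalizer[OF X] monoidD(1)[OF E'] this eq]
  obtain u where u: "u \<in> Hom M (Q X \<otimes> ?e') (Q X)"
    "u \<cdot> (q X \<otimes>\<^sub>a Ident M ?e') = q X \<cdot> (Ident M ?x \<otimes>\<^sub>a ModAct Y) \<cdot> Assoc M ?x ?y ?e'" .
  \<comment> \<open>Two solutions agree after \<open>q X\<close> tensored with \<open>E'\<close>, so
    the description in \<open>tensor_over_module\<close> picks out \<open>u\<close>.\<close>
  have "ModAct (QM X) = u"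
    unfolding tensor_over_module_def Let_def module_data.simps
  proof (rule the_equality)
    show "u \<in> Hom M (Q X \<otimes> ?e') (Q X) \<and>
        u \<cdot> (q X \<otimes>\<^sub>a Ident M ?e') = q X \<cdot> (Ident M ?x \<otimes>\<^sub>a ModAct Y) \<cdot> Assoc M ?x ?y ?e'"
      using u by blast
    fix r assume "r \<in> Hom M (Q X \<otimes> ?e') (Q X) \<and>
        r \<cdot> (q X \<otimes>\<^sub>a Ident M ?e') = q X \<cdot> (Ident M ?x \<otimes>\<^sub>a ModAct Y) \<cdot> Assoc M ?x ?y ?e'"
    then show "r = u"
      using tensor_coequalizer_cancel[OF tensor_over_is_coequalizer[OF X] monoidD(1)[OF E'] _ u(1)] u(2) by simp
  qed
  then show "ModAct (QM X) \<in> Hom M (Q X \<otimes> ?e') (Q X)"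
    "ModAct (QM X) \<cdot> (q X \<otimes>\<^sub>a Ident M ?e') =
      q X \<cdot> (Ident M ?x \<otimes>\<^sub>a ModAct Y) \<cdot> Assoc M ?x ?y ?e'"
    using u by simp_all
qed

lemma tensor_over_module_obj [simp]: "ModObj (QM X) = Q X"
  by (simp add: tensor_over_module_def Let_def)

text \<open>Each law is checked after precomposing with a tensored \<open>q X\<close>, where it
  reduces to the corresponding law for \<open>Y\<close>; the tensored projection is then cancelled.
  It is tensored twice with \<open>E'\<close> for associativity, and with the unit object for the
  unit law, which also uses \<open>runit_tns\<close>.\<close>

lemma right_module_tensor_over_module:
  assumes X: "is_right_module M E X"
  shows "is_right_module M E' (QM X)"
proof -
  note [simp] = bimodule_types right_moduleD(1,2)[OF X] tensor_over_proj(1)[OF X] tensor_over_Obj[OF X] tensor_over_module_act(1)[OF X]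
  let ?e = "MonObj E" and ?e' = "MonObj E'" and ?x = "ModObj X" and ?y = "ModObj Y" and ?I = "MUnit M"
  let ?q = "\<langle>?x \<otimes> ?y, q X, Q X\<rangle>" and ?rY = "\<langle>?y \<otimes> ?e', ModAct Y, ?y\<rangle>"
    and ?r = "\<langle>Q X \<otimes> ?e', ModAct (QM X), Q X\<rangle>"
    and ?m = "\<langle>?e' \<otimes> ?e', MonMult E', ?e'\<rangle>" and ?u = "\<langle>?I, MonUnit E', ?e'\<rangle>"
  have rq: "?r \<bullet> (?q \<boxtimes> \<one> ?e') = ?q \<bullet> (\<one> ?x \<boxtimes> ?rY) \<bullet> \<a> ?x ?y ?e'"
    using tensor_over_module_act(2)[OF X] by (simp add: typed_arrow_defs)
  have ar: "(\<one> ?x \<boxtimes> ?rY) \<bullet> (\<one> ?x \<boxtimes> (?rY \<boxtimes> \<one> ?e')) = \<one> ?x \<boxtimes> (?rY \<bullet> (\<one> ?y \<boxtimes> ?m) \<bullet> \<a> ?y ?e' ?e')"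
    using right_moduleD(3)[OF bimodule_right_module] by (simp add: tns_cmp) (simp add: typed_arrow_defs)
  have ur: "(\<one> ?x \<boxtimes> ?rY) \<bullet> (\<one> ?x \<boxtimes> (\<one> ?y \<boxtimes> ?u)) = \<one> ?x \<boxtimes> \<r> ?y"
    using right_moduleD(4)[OF bimodule_right_module] by (simp add: tns_cmp) (simp add: typed_arrow_defs)
  have rq1: "(?r \<boxtimes> \<one> ?e') \<bullet> ((?q \<boxtimes> \<one> ?e') \<boxtimes> \<one> ?e') = (?q \<bullet> (\<one> ?x \<boxtimes> ?rY) \<bullet> \<a> ?x ?y ?e') \<boxtimes> \<one> ?e'"
    by (simp add: rq[symmetric] tns_cmp)
  have ixm: "(\<one> (Q X) \<boxtimes> ?m) \<bullet> (?q \<boxtimes> \<one> (?e' \<otimes> ?e')) = (?q \<boxtimes> \<one> ?e') \<bullet> (\<one> (?x \<otimes> ?y) \<boxtimes> ?m)"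
    by (rule interchange[symmetric]) simp_all
  have ixu: "(\<one> (Q X) \<boxtimes> ?u) \<bullet> (?q \<boxtimes> \<one> ?I) = (?q \<boxtimes> \<one> ?e') \<bullet> (\<one> (?x \<otimes> ?y) \<boxtimes> ?u)"
    by (rule interchange[symmetric]) simp_all
  have "(?r \<bullet> (?r \<boxtimes> \<one> ?e')) \<bullet> ((?q \<boxtimes> \<one> ?e') \<boxtimes> \<one> ?e') =
      ?q \<bullet> (\<one> ?x \<boxtimes> ?rY) \<bullet> (\<one> ?x \<boxtimes> (\<one> ?y \<boxtimes> ?m)) \<bullet> \<a> ?x ?y (?e' \<otimes> ?e') \<bullet> \<a> (?x \<otimes> ?y) ?e' ?e'"
    by (simp add: rq1 whisker_left whisker_right tail[OF rq] tail[OF assoc_nat] tail[OF ar] assoc_pentagon)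
  also have "\<dots> = (?r \<bullet> (\<one> (Q X) \<boxtimes> ?m) \<bullet> \<a> (Q X) ?e' ?e') \<bullet> ((?q \<boxtimes> \<one> ?e') \<boxtimes> \<one> ?e')"
    by (simp add: assoc_nat_left tail[OF ixm] tail[OF rq] tail[OF assoc_nat_right])
  finally have assoc: "(ModAct (QM X) \<cdot> (ModAct (QM X) \<otimes>\<^sub>a Ident M ?e')) \<cdot> ((q X \<otimes>\<^sub>a Ident M ?e') \<otimes>\<^sub>a Ident M ?e') =
    (ModAct (QM X) \<cdot> (Ident M (Q X) \<otimes>\<^sub>a MonMult E') \<cdot> Assoc M (Q X) ?e' ?e') \<cdot> ((q X \<otimes>\<^sub>a Ident M ?e') \<otimes>\<^sub>a Ident M ?e')"
    by (simp add: typed_arrow_defs)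
  have "(?r \<bullet> (\<one> (Q X) \<boxtimes> ?u)) \<bullet> (?q \<boxtimes> \<one> ?I) = ?q \<bullet> (\<one> ?x \<boxtimes> \<r> ?y) \<bullet> \<a> ?x ?y ?I"
    by (simp add: ixu tail[OF rq] assoc_nat_right tail[OF ur])
  also have "\<dots> = \<r> (Q X) \<bullet> (?q \<boxtimes> \<one> ?I)"
    by (simp add: runit_tns runit_nat)
  finally have unit: "(ModAct (QM X) \<cdot> (Ident M (Q X) \<otimes>\<^sub>a MonUnit E')) \<cdot> (q X \<otimes>\<^sub>a Ident M ?I) = RUnit M (Q X) \<cdot> (q X \<otimes>\<^sub>a Ident M ?I)"
    by (simp add: typed_arrow_defs)
  have "arr (?r \<bullet> (?r \<boxtimes> \<one> ?e'))" "arr (?r \<bullet> (\<one> (Q X) \<boxtimes> ?m) \<bullet> \<a> (Q X) ?e' ?e')" "arr (?r \<bullet> (\<one> (Q X) \<boxtimes> ?u))"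
    by simp_all
  then have H: "ModAct (QM X) \<cdot> (ModAct (QM X) \<otimes>\<^sub>a Ident M ?e') \<in> Hom M ((Q X \<otimes> ?e') \<otimes> ?e') (Q X)"
    "ModAct (QM X) \<cdot> (Ident M (Q X) \<otimes>\<^sub>a MonMult E') \<cdot> Assoc M (Q X) ?e' ?e' \<in> Hom M ((Q X \<otimes> ?e') \<otimes> ?e') (Q X)"
    "ModAct (QM X) \<cdot> (Ident M (Q X) \<otimes>\<^sub>a MonUnit E') \<in> Hom M (Q X \<otimes> ?I) (Q X)"
    by (simp_all add: typed_arrow_defs)
  note e' = monoidD(1)[OF E']
  show ?thesis unfolding is_right_module_def Let_def tensor_over_module_obj
    using tensor_coequalizer_cancel2[OF tensor_over_is_coequalizer[OF X] e' e' H(1,2) assoc]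
      tensor_coequalizer_cancel[OF tensor_over_is_coequalizer[OF X] MUnit_Obj H(3) RUnit_Hom[OF tensor_over_Obj[OF X]] unit]
      tensor_over_Obj[OF X] tensor_over_module_act(1)[OF X] by blast
qed

text \<open>The balancing condition \<open>bal\<close> yields the factorization through the
  coequalizer. Equivariance of \<open>g\<close> shows that the factorization respects the actions of
  \<open>E'\<close> after the tensored projection, which can be cancelled.\<close>

lemma tensor_over_desc:
  assumes X: "is_right_module M E X" and W: "is_right_module M E' W"
    and g: "g \<in> Hom M (ModObj X \<otimes> ModObj Y) (ModObj W)"
    and bal: "g \<cdot> (ModAct X \<otimes>\<^sub>a Ident M (ModObj Y)) =
      g \<cdot> (Ident M (ModObj X) \<otimes>\<^sub>a l) \<cdot> Assoc M (ModObj X) (MonObj E) (ModObj Y)"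
    and eqv: "equivariant E' Y W (ModObj X) g"
  shows "\<exists>!h. h \<in> Hom M (Q X) (ModObj W) \<and> h \<cdot> q X = g"
    and "\<lbrakk>h \<in> Hom M (Q X) (ModObj W); h \<cdot> q X = g\<rbrakk> \<Longrightarrow> h \<in> Hom (Mod M E') (QM X) W"
proof -
  note [simp] = bimodule_types right_moduleD(1,2)[OF X] right_moduleD(1,2)[OF W] tensor_over_proj(1)[OF X] tensor_over_Obj[OF X] tensor_over_module_act(1)[OF X] g
  let ?e = "MonObj E" and ?e' = "MonObj E'" and ?x = "ModObj X" and ?y = "ModObj Y" and ?w = "ModObj W"
  let ?q = "\<langle>?x \<otimes> ?y, q X, Q X\<rangle>" and ?rY = "\<langle>?y \<otimes> ?e', ModAct Y, ?y\<rangle>" and ?l = "\<langle>?e \<otimes> ?y, l, ?y\<rangle>"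
    and ?r = "\<langle>Q X \<otimes> ?e', ModAct (QM X), Q X\<rangle>"  and ?g = "\<langle>?x \<otimes> ?y, g, ?w\<rangle>"
    and ?rW = "\<langle>?w \<otimes> ?e', ModAct W, ?w\<rangle>"
  have "?g \<bullet> ((\<one> ?x \<boxtimes> ?l) \<bullet> \<a> ?x ?e ?y) = (?g \<bullet> (\<one> ?x \<boxtimes> ?l)) \<bullet> \<a> ?x ?e ?y" by simp
  then have "g \<cdot> (ModAct X \<otimes>\<^sub>a Ident M ?y) = g \<cdot> ((Ident M ?x \<otimes>\<^sub>a l) \<cdot> Assoc M ?x ?e ?y)"
    using bal by (simp add: typed_arrow_defs)
  then show "\<exists>!h. h \<in> Hom M (Q X) ?w \<and> h \<cdot> q X = g"
    using tensor_over_is_coequalizer[OF X] g unfolding is_coequalizer_def by blast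
  assume h: "h \<in> Hom M (Q X) ?w" and hq: "h \<cdot> q X = g"
  note [simp] = h
  let ?h = "\<langle>Q X, h, ?w\<rangle>"
  have hq': "?h \<bullet> ?q = ?g" using hq by (simp add: typed_arrow_defs)
  have rq: "?r \<bullet> (?q \<boxtimes> \<one> ?e') = ?q \<bullet> (\<one> ?x \<boxtimes> ?rY) \<bullet> \<a> ?x ?y ?e'"
    using tensor_over_module_act(2)[OF X] by (simp add: typed_arrow_defs)
  have eg: "?g \<bullet> (\<one> ?x \<boxtimes> ?rY) \<bullet> \<a> ?x ?y ?e' = ?rW \<bullet> (?g \<boxtimes> \<one> ?e')"
    using eqv by (simp add: equivariant_def) (simp add: typed_arrow_defs)
  have hq1: "(?h \<boxtimes> \<one> ?e') \<bullet> (?q \<boxtimes> \<one> ?e') = ?g \<boxtimes> \<one> ?e'"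
    by (simp add: tns_cmp hq')
  have "(?h \<bullet> ?r) \<bullet> (?q \<boxtimes> \<one> ?e') = (?rW \<bullet> (?h \<boxtimes> \<one> ?e')) \<bullet> (?q \<boxtimes> \<one> ?e')"
    by (simp add: rq tail[OF hq'] eg hq1)
  then have eq: "(h \<cdot> ModAct (QM X)) \<cdot> (q X \<otimes>\<^sub>a Ident M ?e') = (ModAct W \<cdot> (h \<otimes>\<^sub>a Ident M ?e')) \<cdot> (q X \<otimes>\<^sub>a Ident M ?e')"
    by (simp add: typed_arrow_defs)
  have "h \<cdot> ModAct (QM X) = ModAct W \<cdot> (h \<otimes>\<^sub>a Ident M ?e')"
    by (rule tensor_coequalizer_cancel[OF tensor_over_is_coequalizer[OF X] monoidD(1)[OF E'] _ _ eq])
      (rule Comp_Hom[OF tensor_over_module_act(1)[OF X] h], rule Comp_Hom[OF TensorArr_Hom[OF h Ident_Hom[OF monoidD(1)[OF E']]] right_moduleD(2)[OF W]])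
  then show "h \<in> Hom (Mod M E') (QM X) W"
    using right_module_tensor_over_module[OF X] W h by (simp add: Mod_Hom_iff)
qed

text \<open>Descent is applied to \<open>q X'\<close> after \<open>f\<close> tensored with
  \<open>Y\<close>. This map is balanced because \<open>f\<close> is a module map and
  \<open>q X'\<close> is balanced, and it is equivariant because \<open>f\<close> and the right
  action concern different tensor factors.\<close>

lemma tensor_over_farr:
  assumes f: "f \<in> Hom (Mod M E) X X'"
  shows "farr (tensor_over_functor M E E' Y l) X X' f \<in> Hom (Mod M E') (QM X) (QM X')"
    "farr (tensor_over_functor M E E' Y l) X X' f \<cdot> q X = q X' \<cdot> (f \<otimes>\<^sub>a Ident M (ModObj Y))"
proof -
  have X: "is_right_module M E X" and X': "is_right_module M E X'"
    and fH: "f \<in> Hom M (ModObj X) (ModObj X')"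
    and fa: "f \<cdot> ModAct X = ModAct X' \<cdot> (f \<otimes>\<^sub>a Ident M (MonObj E))"
    using f by (simp_all add: Mod_Hom_iff)
  note [simp] = bimodule_types fH right_moduleD(1,2)[OF X] right_moduleD(1,2)[OF X'] tensor_over_proj(1)[OF X]
    tensor_over_proj(1)[OF X'] tensor_over_Obj[OF X] tensor_over_Obj[OF X'] tensor_over_module_act(1)[OF X']
  let ?e = "MonObj E" and ?e' = "MonObj E'" and ?x = "ModObj X" and ?x' = "ModObj X'" and ?y = "ModObj Y"
  let ?f = "\<langle>?x, f, ?x'\<rangle>" and ?q = "\<langle>?x' \<otimes> ?y, q X', Q X'\<rangle>" and ?l = "\<langle>?e \<otimes> ?y, l, ?y\<rangle>"
    and ?rX = "\<langle>?x \<otimes> ?e, ModAct X, ?x\<rangle>" and ?rX' = "\<langle>?x' \<otimes> ?e, ModAct X', ?x'\<rangle>"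
    and ?rY = "\<langle>?y \<otimes> ?e', ModAct Y, ?y\<rangle>" and ?r = "\<langle>Q X' \<otimes> ?e', ModAct (QM X'), Q X'\<rangle>"
  have ql: "?q \<bullet> (?rX' \<boxtimes> \<one> ?y) = ?q \<bullet> (\<one> ?x' \<boxtimes> ?l) \<bullet> \<a> ?x' ?e ?y"
    using tensor_over_proj(2)[OF X'] by (simp add: typed_arrow_defs)
  have fa': "(?f \<boxtimes> \<one> ?y) \<bullet> (?rX \<boxtimes> \<one> ?y) = (?rX' \<boxtimes> \<one> ?y) \<bullet> ((?f \<boxtimes> \<one> ?e) \<boxtimes> \<one> ?y)"
    using fa by (simp add: tns_cmp) (simp add: typed_arrow_defs)
  have rq: "?r \<bullet> (?q \<boxtimes> \<one> ?e') = ?q \<bullet> (\<one> ?x' \<boxtimes> ?rY) \<bullet> \<a> ?x' ?y ?e'"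
    using tensor_over_module_act(2)[OF X'] by (simp add: typed_arrow_defs)
  have ixl: "(?f \<boxtimes> \<one> ?y) \<bullet> (\<one> ?x \<boxtimes> ?l) = (\<one> ?x' \<boxtimes> ?l) \<bullet> (?f \<boxtimes> \<one> (?e \<otimes> ?y))"
    by (rule interchange) simp_all
  have ixr: "(?f \<boxtimes> \<one> ?y) \<bullet> (\<one> ?x \<boxtimes> ?rY) = (\<one> ?x' \<boxtimes> ?rY) \<bullet> (?f \<boxtimes> \<one> (?y \<otimes> ?e'))"
    by (rule interchange) simp_all
  let ?g = "q X' \<cdot> (f \<otimes>\<^sub>a Ident M ?y)" and ?G = "?q \<bullet> (?f \<boxtimes> \<one> ?y)"
  have gH: "?g \<in> Hom M (?x \<otimes> ?y) (ModObj (QM X'))"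
    using Comp_Hom[OF TensorArr_Hom[OF fH Ident_Hom[OF right_moduleD(1)[OF bimodule_right_module]]] tensor_over_proj(1)[OF X']] by simp
  have "?G \<bullet> (?rX \<boxtimes> \<one> ?y) = ?G \<bullet> (\<one> ?x \<boxtimes> ?l) \<bullet> \<a> ?x ?e ?y"
    by (simp add: fa' tail[OF ql] tail[OF ixl] assoc_nat_left)
  then have bal: "?g \<cdot> (ModAct X \<otimes>\<^sub>a Ident M ?y) = ?g \<cdot> (Ident M ?x \<otimes>\<^sub>a l) \<cdot> Assoc M ?x ?e ?y"
    by (simp add: typed_arrow_defs)
  have "?G \<bullet> (\<one> ?x \<boxtimes> ?rY) \<bullet> \<a> ?x ?y ?e' = ?r \<bullet> (?G \<boxtimes> \<one> ?e')"
    by (simp add: whisker_right tail[OF rq] tail[OF ixr] assoc_nat_left)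
  then have "equivariant E' Y (QM X') ?x (und ?G)"
    by (intro equivariantI[OF E']) simp_all
  then have eqv: "equivariant E' Y (QM X') ?x ?g" by (simp add: typed_arrow_defs)
  note desc = tensor_over_desc[OF X right_module_tensor_over_module[OF X'] gH bal eqv]
  let ?h = "farr (tensor_over_functor M E E' Y l) X X' f"
  have "?h \<in> Hom M (Q X) (Q X') \<and> ?h \<cdot> q X = ?g"
    unfolding tensor_over_functor_def Let_def functor_data.simps
    by (rule theI'[OF desc(1)[unfolded tensor_over_module_obj]])
  then show "?h \<in> Hom (Mod M E') (QM X) (QM X')" "?h \<cdot> q X = ?g"
    using desc(2)[of ?h] by simp_all
qed

lemma tensor_over_fobj: "fobj (tensor_over_functor M E E' Y l) X = QM X"
  by (simp add: tensor_over_functor_def Let_def)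

text \<open>Identities and composites are compared after precomposing with the projection, which is
  then cancelled.\<close>

lemma functor_tensor_over: "is_functor (Mod M E) (Mod M E') (tensor_over_functor M E E' Y l)"
proof -
  let ?T = "tensor_over_functor M E E' Y l" and ?y = "ModObj Y"
  have id: "farr ?T X X (Ident M (ModObj X)) = Ident M (Q X)" if X: "is_right_module M E X" for X
  proof -
    have I: "Ident M (ModObj X) \<in> Hom (Mod M E) X X"
      using category.Ident_Hom[OF category_Mod[OF E], of X] X by simp
    note t = tensor_over_farr[OF I]
    show ?thesis
      by (rule coequalizer_cancel[OF tensor_over_is_coequalizer[OF X] _ Ident_Hom[OF tensor_over_Obj[OF X]]])
        (use t in \<open>simp_all add: Mod_Hom_iff TensorArr_Ident right_moduleD(1)[OF X] right_moduleD(1)[OF bimodule_right_module]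
          Ident_left[OF tensor_over_proj(1)[OF X]] Ident_right[OF tensor_over_proj(1)[OF X]]\<close>)
  qed
  have comp: "farr ?T X V (g \<cdot> f) = farr ?T W V g \<cdot> farr ?T X W f"
    if f: "f \<in> Hom (Mod M E) X W" and g: "g \<in> Hom (Mod M E) W V" for X W V f g
  proof -
    have X: "is_right_module M E X" and W: "is_right_module M E W" and V: "is_right_module M E V"
      and fH: "f \<in> Hom M (ModObj X) (ModObj W)" and gH: "g \<in> Hom M (ModObj W) (ModObj V)"
      using f g by (simp_all add: Mod_Hom_iff)
    have gf: "g \<cdot> f \<in> Hom (Mod M E) X V"
      using category.Comp_Hom[OF category_Mod[OF E] f g] by simp
    note tf = tensor_over_farr[OF f] and tg = tensor_over_farr[OF g] and tgf = tensor_over_farr[OF gf]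
    have H: "farr ?T X W f \<in> Hom M (Q X) (Q W)" "farr ?T W V g \<in> Hom M (Q W) (Q V)"
      "farr ?T X V (g \<cdot> f) \<in> Hom M (Q X) (Q V)"
      using tf(1) tg(1) tgf(1) by (simp_all add: Mod_Hom_iff)
    note i = Ident_Hom[OF right_moduleD(1)[OF bimodule_right_module]]
    note fi = TensorArr_Hom[OF fH i] and gi = TensorArr_Hom[OF gH i]
    have "(farr ?T W V g \<cdot> farr ?T X W f) \<cdot> q X = farr ?T W V g \<cdot> (q W \<cdot> (f \<otimes>\<^sub>a Ident M ?y))"
      by (simp add: Comp_assoc[OF tensor_over_proj(1)[OF X] H(1,2)] tf(2))
    also have "\<dots> = (q V \<cdot> (g \<otimes>\<^sub>a Ident M ?y)) \<cdot> (f \<otimes>\<^sub>a Ident M ?y)"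
      by (simp add: Comp_assoc[OF fi tensor_over_proj(1)[OF W] H(2), symmetric] tg(2))
    also have "\<dots> = q V \<cdot> ((g \<cdot> f) \<otimes>\<^sub>a Ident M ?y)"
      using TensorArr_Comp[OF fH gH i i] Ident_left[OF i]
      by (simp add: Comp_assoc[OF fi gi tensor_over_proj(1)[OF V]])
    finally show ?thesis
      by (intro coequalizer_cancel[OF tensor_over_is_coequalizer[OF X] H(3) Comp_Hom[OF H(1,2)]]) (simp add: tgf(2))
  qed
  show ?thesis
    unfolding is_functor_def
    using category_Mod[OF E] category_Mod[OF E'] right_module_tensor_over_module tensor_over_farr(1) id comp
    by (simp add: tensor_over_fobj)
qed

end

section \<open>The transformation of an enriched functor\<close>

lemma regular_module_sel [simp]:
  "ModObj (regular_module E) = MonObj E" "ModAct (regular_module E) = MonMult E"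
  by (simp_all add: regular_module_def)

lemma regular_module:
  assumes "is_monoid M E" shows "is_right_module M E (regular_module E)"
  using assms by (simp add: is_right_module_def is_monoid_def Let_def)

text \<open>This is the associativity law of the action, read as linearity in the second
  factor.\<close>

lemma equivariant_action:
  assumes X: "is_right_module M E X"
  shows "equivariant E (regular_module E) X (ModObj X) (ModAct X)"
  using right_moduleD[OF X] by (simp add: equivariant_def)

section \<open>The maps \<open>\<sigma> X\<close> obtained from the enrichment, their laws, and
  their descent to the tensor product\<close>

context
  fixes E E' :: "('o, 'a) monoid_data"
    and F :: "(('o, 'a) module_data, 'a, ('o, 'a) module_data, 'a) functor_data"
    and \<Phi> :: "('o, 'a) module_data \<Rightarrow> ('o, 'a) module_data \<Rightarrow> 'a"
  assumes E: "is_monoid M E" and E': "is_monoid M E'" and F: "is_enriched_functor M E E' F \<Phi>"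
begin

abbreviation "R \<equiv> regular_module E"
abbreviation "FR \<equiv> fobj F R"

lemmas regular = regular_module[OF E]

lemma functor_F: "is_functor (Mod M E) (Mod M E') F"
  using F by (simp add: is_enriched_functor_def)

lemma F_module: "is_right_module M E X \<Longrightarrow> is_right_module M E' (fobj F X)"
  using functor_F by (simp add: is_functor_def)

lemma enrichment:
  assumes "is_right_module M E X" "is_right_module M E V"
  shows "\<Phi> X V \<in> Hom M (modhom M E X V) (modhom M E' (fobj F X) (fobj F V))"
  using F assms by (simp add: is_enriched_functor_def)

text \<open>The comparison map \<open>X \<rightarrow> modhom M E R X\<close> of the enriched Yoneda
  lemma. The choice is harmless: \<open>mod_uncurry_inj\<close> leaves only one candidate.\<close>

definition yoneda :: "('o, 'a) module_data \<Rightarrow> 'a" where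
  "yoneda X = (SOME k. k \<in> Hom M (ModObj X) (modhom M E R X) \<and> mod_uncurry E R X k = ModAct X)"

lemma yoneda:
  assumes X: "is_right_module M E X"
  shows "yoneda X \<in> Hom M (ModObj X) (modhom M E R X)" "mod_uncurry E R X (yoneda X) = ModAct X"
proof -
  have "\<exists>k. k \<in> Hom M (ModObj X) (modhom M E R X) \<and> mod_uncurry E R X k = ModAct X"
    using mod_uncurry_surj[OF E regular X equivariant_action[OF X]] by blast
  from someI_ex[OF this]
  show "yoneda X \<in> Hom M (ModObj X) (modhom M E R X)" "mod_uncurry E R X (yoneda X) = ModAct X"
    by (simp_all add: yoneda_def)
qed

definition \<sigma> :: "('o, 'a) module_data \<Rightarrow> 'a" where
  "\<sigma> X = mod_uncurry E' FR (fobj F X) (\<Phi> R X \<cdot> yoneda X)"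

lemma enrichment_yoneda:
  "is_right_module M E X \<Longrightarrow> \<Phi> R X \<cdot> yoneda X \<in> Hom M (ModObj X) (modhom M E' FR (fobj F X))"
  by (rule Comp_Hom[OF yoneda(1) enrichment[OF regular]])

lemma equivariant_\<sigma>:
  assumes X: "is_right_module M E X"
  shows "equivariant E' FR (fobj F X) (ModObj X) (\<sigma> X)"
  unfolding \<sigma>_def by (rule equivariant_mod_uncurry[OF E' F_module[OF regular] F_module[OF X] enrichment_yoneda[OF X]])

lemma \<sigma>_Hom:
  "is_right_module M E X \<Longrightarrow> \<sigma> X \<in> Hom M (ModObj X \<otimes> ModObj FR) (ModObj (fobj F X))"
  using equivariant_\<sigma> by (simp add: equivariant_def)

lemma \<sigma>_action:
  assumes X: "is_right_module M E X"
  shows "\<sigma> X \<cdot> (ModAct X \<otimes>\<^sub>a Ident M (ModObj FR)) =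
    \<sigma> X \<cdot> (Ident M (ModObj X) \<otimes>\<^sub>a \<sigma> R) \<cdot> Assoc M (ModObj X) (MonObj E) (ModObj FR)"
proof -
  note a = right_moduleD(2)[OF X] and y = yoneda(1)[OF X] and yR = yoneda(1)[OF regular]
  note FR = F_module[OF regular] and FX = F_module[OF X]
  note c = mod_uncurry_comp[OF E regular regular X] and c' = mod_uncurry_comp[OF E' FR FR FX]
  note yy = TensorArr_Hom[OF y yR]
  note p = enrichment[OF regular X] and pR = enrichment[OF regular regular]
  \<comment> \<open>The action on \<open>X\<close> corresponds to composition of module maps. Under
    the adjunction this is the associativity law of the action, the multiplication of
    \<open>E\<close> being what \<open>yoneda R\<close> uncurries to.\<close>
  have "yoneda X \<cdot> ModAct X = modhom_comp M E R R X \<cdot> (yoneda X \<otimes>\<^sub>a yoneda R)"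
  proof (rule mod_uncurry_inj[OF E regular X Comp_Hom[OF a y]])
    show "modhom_comp M E R R X \<cdot> (yoneda X \<otimes>\<^sub>a yoneda R) \<in> Hom M (ModObj X \<otimes> MonObj E) (modhom M E R X)"
      using Comp_Hom[OF yy c(1)] by simp
    show "mod_uncurry E R X (yoneda X \<cdot> ModAct X) =
        mod_uncurry E R X (modhom_comp M E R R X \<cdot> (yoneda X \<otimes>\<^sub>a yoneda R))"
      by (simp add: mod_uncurry_natural[OF E regular X y a] c(2)[OF y yR] yoneda(2)[OF X] yoneda(2)[OF regular]
          right_moduleD(3)[OF X])
  qed
  then have "(\<Phi> R X \<cdot> yoneda X) \<cdot> ModAct X = \<Phi> R X \<cdot> (modhom_comp M E R R X \<cdot> (yoneda X \<otimes>\<^sub>a yoneda R))"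
    by (simp add: Comp_assoc[OF a y p])
  also have "\<dots> = (\<Phi> R X \<cdot> modhom_comp M E R R X) \<cdot> (yoneda X \<otimes>\<^sub>a yoneda R)"
    by (simp add: Comp_assoc[OF yy c(1) p])
  \<comment> \<open>Compatibility of the enrichment with composition carries the identity over to
    \<open>E'\<close>, where uncurrying it gives the claim.\<close>
  also have "\<Phi> R X \<cdot> modhom_comp M E R R X = modhom_comp M E' FR FR (fobj F X) \<cdot> (\<Phi> R X \<otimes>\<^sub>a \<Phi> R R)"
    using F regular X by (simp add: is_enriched_functor_def)
  also have "\<dots> \<cdot> (yoneda X \<otimes>\<^sub>a yoneda R) =
      modhom_comp M E' FR FR (fobj F X) \<cdot> ((\<Phi> R X \<cdot> yoneda X) \<otimes>\<^sub>a (\<Phi> R R \<cdot> yoneda R))"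
    by (simp add: Comp_assoc[OF yy TensorArr_Hom[OF p pR] c'(1)] TensorArr_Comp[OF y p yR pR])
  finally have "mod_uncurry E' FR (fobj F X) ((\<Phi> R X \<cdot> yoneda X) \<cdot> ModAct X) =
    mod_uncurry E' FR (fobj F X)
      (modhom_comp M E' FR FR (fobj F X) \<cdot> ((\<Phi> R X \<cdot> yoneda X) \<otimes>\<^sub>a (\<Phi> R R \<cdot> yoneda R)))"
    by simp
  then show ?thesis
    using c'(2)[OF enrichment_yoneda[OF X] enrichment_yoneda[OF regular]]
    by (simp add: mod_uncurry_natural[OF E' FR FX enrichment_yoneda[OF X] a] \<sigma>_def)
qed

lemma \<sigma>_unit: "\<sigma> R \<cdot> (MonUnit E \<otimes>\<^sub>a Ident M (ModObj FR)) = LUnit M (ModObj FR)"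
proof -
  have u: "MonUnit E \<in> Hom M (MUnit M) (ModObj R)" using monoidD(3)[OF E] by simp
  note y = yoneda(1)[OF regular] and FR = F_module[OF regular]
  \<comment> \<open>Under the adjunction this is the left unit law of \<open>E\<close>: the unit
    element corresponds to the identity of the regular module.\<close>
  have "yoneda R \<cdot> MonUnit E = modhom_id M E R"
    by (rule mod_uncurry_inj[OF E regular regular Comp_Hom[OF u y] mod_uncurry_id(1)[OF E regular]])
      (use E in \<open>simp add: mod_uncurry_natural[OF E regular regular y u] mod_uncurry_id(2)[OF E regular] yoneda(2)[OF regular]
        is_monoid_def Let_def\<close>)
  then have "(\<Phi> R R \<cdot> yoneda R) \<cdot> MonUnit E = \<Phi> R R \<cdot> modhom_id M E R"
    by (simp add: Comp_assoc[OF u y enrichment[OF regular regular]])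
  also have "\<dots> = modhom_id M E' FR"
    using F regular by (simp add: is_enriched_functor_def)
  finally show ?thesis
    using mod_uncurry_natural[OF E' FR FR enrichment_yoneda[OF regular] u] mod_uncurry_id(2)[OF E' FR]
    by (simp add: \<sigma>_def)
qed

text \<open>The enrichment is natural in both variables. Here only the second varies:
  postcomposition with \<open>f\<close> is \<open>modhom_map\<close> with the identity of
  \<open>R\<close> in the first, and it commutes with \<open>yoneda\<close> because \<open>f\<close>
  is a module map.\<close>

lemma \<sigma>_natural:
  assumes f: "f \<in> Hom (Mod M E) X X'"
  shows "\<sigma> X' \<cdot> (f \<otimes>\<^sub>a Ident M (ModObj FR)) = farr F X X' f \<cdot> \<sigma> X"
proof -
  have X: "is_right_module M E X" and X': "is_right_module M E X'"
    and fH: "f \<in> Hom M (ModObj X) (ModObj X')"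
    and fa: "f \<cdot> ModAct X = ModAct X' \<cdot> (f \<otimes>\<^sub>a Ident M (MonObj E))"
    using f by (simp_all add: Mod_Hom_iff)
  note [simp del] = regular_module_sel
  have i: "Ident M (ModObj R) \<in> Hom (Mod M E) R R"
    using category.Ident_Hom[OF category_Mod[OF E], of R] regular by simp
  have i': "Ident M (ModObj FR) \<in> Hom (Mod M E') FR FR"
    using category.Ident_Hom[OF category_Mod[OF E'], of FR] F_module[OF regular] by simp
  have Ff: "farr F X X' f \<in> Hom (Mod M E') (fobj F X) (fobj F X')"
    using functor_F f by (simp add: is_functor_def)
  \<comment> \<open>Naturality of \<open>\<Phi>\<close> mentions \<open>F\<close> applied to the
    identity of \<open>R\<close>; this turns it into the identity of \<open>FR\<close>.\<close>
  have Fi: "farr F R R (Ident M (ModObj R)) = Ident M (ModObj FR)"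
    using functor_F regular unfolding is_functor_def by (simp del: regular_module_sel)
  note y = yoneda(1)[OF X] and y' = yoneda(1)[OF X'] and FR = F_module[OF regular] and FX = F_module[OF X] and FX' = F_module[OF X']
  note m = mod_uncurry_map[OF E i f] and m' = mod_uncurry_map[OF E' i' Ff]
  note p = enrichment[OF regular X] and p' = enrichment[OF regular X']
  let ?m = "modhom_map M E R R X X' (Ident M (ModObj R)) f"
    and ?m' = "modhom_map M E' FR FR (fobj F X) (fobj F X') (Ident M (ModObj FR)) (farr F X X' f)"
  have O: "ModObj X \<in> Obj M" "MonObj E \<in> Obj M" "ModObj FR \<in> Obj M"
    using right_moduleD(1)[OF X] right_moduleD(1)[OF FR] monoidD(1)[OF E] by simp_all
  have "mod_uncurry E R X' (yoneda X' \<cdot> f) = ModAct X' \<cdot> (f \<otimes>\<^sub>a Ident M (MonObj E))"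
    by (simp only: mod_uncurry_natural[OF E regular X' y' fH] yoneda(2)[OF X'] regular_module_sel)
  \<comment> \<open>Linearity of \<open>f\<close>. The identity factor is appended to match
    \<open>mod_uncurry_map\<close>, which produces a factor \<open>1 \<otimes> u\<close>, here with
    \<open>u\<close> an identity.\<close>
  also have "\<dots> = f \<cdot> ModAct X \<cdot> Ident M (ModObj X \<otimes> MonObj E)"
    using fa Ident_right[OF right_moduleD(2)[OF X]] by simp
  also have "\<dots> = mod_uncurry E R X' (?m \<cdot> yoneda X)"
    unfolding m(2)[OF y] yoneda(2)[OF X] by (simp only: regular_module_sel TensorArr_Ident[OF O(1,2)])
  finally have "yoneda X' \<cdot> f = ?m \<cdot> yoneda X"
    by (rule mod_uncurry_inj[OF E regular X' Comp_Hom[OF fH y'] Comp_Hom[OF y m(1)]])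
  then have "(\<Phi> R X' \<cdot> yoneda X') \<cdot> f = (\<Phi> R X' \<cdot> ?m) \<cdot> yoneda X"
    by (simp add: Comp_assoc[OF fH y' p'] Comp_assoc[OF y m(1) p'])
  also have "\<Phi> R X' \<cdot> ?m = ?m' \<cdot> \<Phi> R X"
    using F i f Fi unfolding is_enriched_functor_def by metis
  also have "\<dots> \<cdot> yoneda X = ?m' \<cdot> (\<Phi> R X \<cdot> yoneda X)"
    by (rule Comp_assoc[OF y p m'(1)])
  finally have "\<sigma> X' \<cdot> (f \<otimes>\<^sub>a Ident M (ModObj FR)) = farr F X X' f \<cdot> \<sigma> X \<cdot> Ident M (ModObj X \<otimes> ModObj FR)"
    using mod_uncurry_natural[OF E' FR FX' enrichment_yoneda[OF X'] fH] m'(2)[OF enrichment_yoneda[OF X]]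
    by (simp add: \<sigma>_def TensorArr_Ident O)
  then show ?thesis by (simp add: Ident_right[OF \<sigma>_Hom[OF X]])
qed

text \<open>At the regular module, \<open>\<sigma>_action\<close> is the associativity of the left
  action, as the action of \<open>R\<close> is the multiplication of \<open>E\<close>. The
  compatibility with the right action is the equivariance of \<open>\<sigma> R\<close>.\<close>

lemma bimodule_\<sigma>: "is_bimodule M E E' FR (\<sigma> R)"
proof -
  note FR = F_module[OF regular]
  have "is_left_module M E \<lparr>ModObj = ModObj FR, ModAct = \<sigma> R\<rparr>"
    using right_moduleD(1)[OF FR] \<sigma>_Hom[OF regular] \<sigma>_action[OF regular] \<sigma>_unit
    by (simp add: is_left_module_def)
  then show ?thesis
    using FR equivariant_\<sigma>[OF regular] by (simp add: is_bimodule_def equivariant_def)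
qed

text \<open>The component \<open>\<tau> X\<close> is the factorization of \<open>\<sigma> X\<close>
  through the projection: \<open>\<sigma>_action\<close> is the balancing condition and
  \<open>equivariant_\<sigma>\<close> makes the factorization a map of
  \<open>E'\<close>-modules.\<close>

lemma ex_nat_trans_tensor_over:
  "\<exists>\<tau>. is_nat_trans (Mod M E) (Mod M E') (tensor_over_functor M E E' FR (\<sigma> R)) F \<tau>"
proof -
  let ?T = "tensor_over_functor M E E' FR (\<sigma> R)" and ?Y = "\<lparr>ModObj = ModObj FR, ModAct = \<sigma> R\<rparr>"
  let ?Q = "\<lambda>X. tensor_over M E X ?Y" and ?q = "\<lambda>X. tensor_over_proj M E X ?Y"
  note b = E E' bimodule_\<sigma>
  have ex: "\<exists>h. h \<in> Hom (Mod M E') (fobj ?T X) (fobj F X) \<and> h \<cdot> ?q X = \<sigma> X" if X: "is_right_module M E X" for X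
  proof -
    note desc = tensor_over_desc[OF b X F_module[OF X] \<sigma>_Hom[OF X] \<sigma>_action[OF X] equivariant_\<sigma>[OF X]]
    then show ?thesis unfolding tensor_over_fobj[OF b] by blast
  qed
  define \<tau> where "\<tau> X = (SOME h. h \<in> Hom (Mod M E') (fobj ?T X) (fobj F X) \<and> h \<cdot> ?q X = \<sigma> X)" for X
  have \<tau>: "\<tau> X \<in> Hom (Mod M E') (fobj ?T X) (fobj F X)" "\<tau> X \<cdot> ?q X = \<sigma> X"
    if X: "is_right_module M E X" for X
    using someI_ex[OF ex[OF X]] unfolding \<tau>_def by blast+
  have nat: "\<tau> X' \<cdot> farr ?T X X' f = farr F X X' f \<cdot> \<tau> X" if f: "f \<in> Hom (Mod M E) X X'" for X X' f
  proof -
    have X: "is_right_module M E X" and X': "is_right_module M E X'" and fH: "f \<in> Hom M (ModObj X) (ModObj X')"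
      using f by (simp_all add: Mod_Hom_iff)
    have Ff: "farr F X X' f \<in> Hom M (ModObj (fobj F X)) (ModObj (fobj F X'))"
      using functor_F f by (simp add: is_functor_def Mod_Hom_iff)
    note t = tensor_over_farr[OF b f]
    have Tf: "farr ?T X X' f \<in> Hom M (?Q X) (?Q X')"
      using t(1) by (simp add: Mod_Hom_iff tensor_over_module_obj[OF b])
    have H: "\<tau> X \<in> Hom M (?Q X) (ModObj (fobj F X))" if "is_right_module M E X" for X
      using \<tau>(1)[OF that] by (simp add: Mod_Hom_iff tensor_over_fobj[OF b] tensor_over_module_obj[OF b])
    note q = tensor_over_proj(1)[OF b X] and q' = tensor_over_proj(1)[OF b X']
    note fi = TensorArr_Hom[OF fH Ident_Hom[OF right_moduleD(1)[OF F_module[OF regular]]]]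
    \<comment> \<open>After precomposing with the projection the naturality square becomes
      \<open>\<sigma>_natural\<close>, and the projection can be cancelled.\<close>
    have "(\<tau> X' \<cdot> farr ?T X X' f) \<cdot> ?q X = \<sigma> X' \<cdot> (f \<otimes>\<^sub>a Ident M (ModObj FR))"
      by (simp add: Comp_assoc[OF q Tf H[OF X']] t(2) Comp_assoc[OF fi q' H[OF X'], symmetric] \<tau>(2)[OF X'])
    also have "\<dots> = (farr F X X' f \<cdot> \<tau> X) \<cdot> ?q X"
      by (simp add: \<sigma>_natural[OF f] Comp_assoc[OF q H[OF X] Ff] \<tau>(2)[OF X])
    finally show ?thesis
      by (rule coequalizer_cancel[OF tensor_over_is_coequalizer[OF b X] Comp_Hom[OF Tf H[OF X']] Comp_Hom[OF H[OF X] Ff]])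
  qed
  have "is_nat_trans (Mod M E) (Mod M E') ?T F \<tau>"
    unfolding is_nat_trans_def using functor_tensor_over[OF b] functor_F \<tau>(1) nat by simp
  then show ?thesis by blast
qed

end

end

theorem proposition0p6:
  fixes M :: "('o, 'a) closed_monoidal_data"
    and E E' :: "('o, 'a) monoid_data"
    and F :: "(('o, 'a) module_data, 'a, ('o, 'a) module_data, 'a) functor_data"
    and \<Phi> :: "('o, 'a) module_data \<Rightarrow> ('o, 'a) module_data \<Rightarrow> 'a"
  assumes "closed_symmetric_monoidal_category M"
    and "has_finite_colimits M" and "has_finite_limits M"
    and "is_monoid M E" and "is_monoid M E'"
    and "is_enriched_functor M E E' F \<Phi>"
  shows "\<exists>l. is_bimodule M E E' (fobj F (regular_module E)) l \<and>
           (\<exists>\<tau>. is_nat_trans (Mod M E) (Mod M E')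
                  (tensor_over_functor M E E' (fobj F (regular_module E)) l) F \<tau>)"
proof -
  interpret bicomplete_closed_smc M
    using assms(1-3) by (simp add: bicomplete_closed_smc_def closed_smc_def bicomplete_closed_smc_axioms_def)
  \<comment> \<open>The left action of \<open>E\<close> is \<open>\<sigma>\<close> at the regular
    module.\<close>
  show ?thesis
    using bimodule_\<sigma>[OF assms(4-6)] ex_nat_trans_tensor_over[OF assms(4-6)] by blast
qed

end
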